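(* For all integers $a,b$ with $a+b>0$ and every symmetric function $F[X]$, $$\tfrac1M\big(D_aD_b^*-D_b^*D_a\big)F[X]=\frac{(qt)^b}{qt-1}\,h_{a+b}\Big[X\big(\tfrac1{qt}-1\big)\Big]\,F[X].$$
   Context: Work over $\mathbb{Q}(q,t)$; $\Lambda$ is the algebra of symmetric functions in an infinite alphabet $X=x_1+x_2+\cdots$. Plethystic notation: $p_k[E]$ is $E$ with every variable (including $q,t$) raised to the $k$-th power, and $F[E]$ is obtained by writing $F$ in power sums and substituting $p_k\mapsto p_k[E]$. $\Omega[E]=\exp(\sum_{k\ge1}p_k[E]/k)$, so $\Omega[zX]=\sum_m z^mh_m[X]$. $M=(1-t)(1-q)$, $\widetilde M=(1-1/t)(1-1/q)$. For $k\in\mathbb{Z}$: $D_kF[X]=F[X+\tfrac Mz]\Omega[-zX]\big|_{z^k}$ and $D_k^*F[X]=F[X-\tfrac{\widetilde M}{z}]\Omega[zX]\big|_{z^k}$, where $|_{z^k}$ denotes the coefficient of $z^k$. *)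

theory Defs
  imports
    "HOL-Computational_Algebra.Computational_Algebra"
    "HOL-Library.Poly_Mapping"
begin

section \<open>Formal power series in the variables $x_0, x_1, x_2, \ldots$\<close>

text \<open>A monomial is its exponent vector of type \<^typ>\<open>nat \<Rightarrow>\<^sub>0 nat\<close>.\<close>

typedef 'a mfps = "UNIV :: ((nat \<Rightarrow>\<^sub>0 nat) \<Rightarrow> 'a) set"
  morphisms mfps_nth Abs_mfps ..

setup_lifting type_definition_mfps

lemma mfps_eqI: "(\<And>m. mfps_nth f m = mfps_nth g m) \<Longrightarrow> f = g"
  by transfer auto

lemma finite_monom_splits: "finite {(a, b). a + b = (m :: nat \<Rightarrow>\<^sub>0 nat)}"
proof -
  let ?A = "{a :: nat \<Rightarrow>\<^sub>0 nat. \<exists>b. a + b = m}"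
  let ?N = "\<Sum>i\<in>Poly_Mapping.keys m. Poly_Mapping.lookup m i"
  let ?S = "{f :: nat \<Rightarrow> nat. \<forall>x. (x \<in> Poly_Mapping.keys m \<longrightarrow> f x \<in> {..?N})
              \<and> (x \<notin> Poly_Mapping.keys m \<longrightarrow> f x = 0)}"
  have le: "Poly_Mapping.lookup a i \<le> Poly_Mapping.lookup m i" if "a \<in> ?A" for a i
    using that by (auto simp: Poly_Mapping.lookup_add)
  have "Poly_Mapping.lookup ` ?A \<subseteq> ?S"
  proof safe
    fix a b :: "nat \<Rightarrow>\<^sub>0 nat" and i assume m: "m = a + b"
    show "Poly_Mapping.lookup a i = 0" if "i \<notin> Poly_Mapping.keys (a + b)"
      using that by (simp add: Poly_Mapping.in_keys_iff Poly_Mapping.lookup_add)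
    assume "i \<in> Poly_Mapping.keys (a + b)"
    then have "Poly_Mapping.lookup (a + b) i
        \<le> (\<Sum>i\<in>Poly_Mapping.keys (a + b). Poly_Mapping.lookup (a + b) i)"
      by (intro member_le_sum) auto
    with le[of a i] m
    show "Poly_Mapping.lookup a i
        \<le> (\<Sum>i\<in>Poly_Mapping.keys (a + b). Poly_Mapping.lookup (a + b) i)"
      by (simp add: Poly_Mapping.lookup_add)
  qed
  moreover have "finite ?S" by (rule finite_set_of_finite_funs) auto
  ultimately have "finite (Poly_Mapping.lookup ` ?A)" by (rule finite_subset)
  then have "finite ?A"
    by (rule finite_imageD) (auto intro!: inj_onI poly_mapping_eqI)
  moreover have "{(a, b). a + b = m} = (\<lambda>a. (a, m - a)) ` ?A" by force
  ultimately show ?thesis by simp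
qed

instantiation mfps :: (comm_ring_1) comm_ring_1
begin

lift_definition zero_mfps :: "'a mfps" is "\<lambda>_. 0" .
lift_definition one_mfps :: "'a mfps" is "\<lambda>m. if m = 0 then 1 else 0" .
lift_definition plus_mfps :: "'a mfps \<Rightarrow> 'a mfps \<Rightarrow> 'a mfps" is "\<lambda>f g m. f m + g m" .
lift_definition minus_mfps :: "'a mfps \<Rightarrow> 'a mfps \<Rightarrow> 'a mfps" is "\<lambda>f g m. f m - g m" .
lift_definition uminus_mfps :: "'a mfps \<Rightarrow> 'a mfps" is "\<lambda>f m. - f m" .
lift_definition times_mfps :: "'a mfps \<Rightarrow> 'a mfps \<Rightarrow> 'a mfps"
  is "\<lambda>f g m. \<Sum>(a, b)\<in>{(a, b). a + b = m}. f a * g b" .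

instance
proof
  fix f g h :: "'a mfps"
  show "f * g * h = f * (g * h)"
  proof transfer
    fix f g h :: "(nat \<Rightarrow>\<^sub>0 nat) \<Rightarrow> 'a"
    have "(\<Sum>(a, c)\<in>{(a, c). a + c = m}. (\<Sum>(x, y)\<in>{(x, y). x + y = a}. f x * g y) * h c)
        = (\<Sum>(x, d)\<in>{(x, d). x + d = m}. f x * (\<Sum>(y, c)\<in>{(y, c). y + c = d}. g y * h c))"
      (is "?L = ?R") for m
    proof -
      have "?L = (\<Sum>p\<in>{(a, c). a + c = m}. \<Sum>r\<in>{(x, y). x + y = fst p}.
                    f (fst r) * g (snd r) * h (snd p))"
        by (auto intro!: sum.cong simp: sum_distrib_right)
      also have "\<dots> = (\<Sum>s\<in>(SIGMA p:{(a, c). a + c = m}. {(x, y). x + y = fst p}).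
                    f (fst (snd s)) * g (snd (snd s)) * h (snd (fst s)))"
        by (subst sum.Sigma) (auto simp: finite_monom_splits[unfolded case_prod_unfold] case_prod_unfold)
      also have "\<dots> = (\<Sum>s\<in>(SIGMA p:{(x, d). x + d = m}. {(y, c). y + c = snd p}).
                    f (fst (fst s)) * (g (fst (snd s)) * h (snd (snd s))))"
        by (rule sum.reindex_bij_witness
            [where i = "\<lambda>((x, d), (y, c)). ((x + y, c), (x, y))"
               and j = "\<lambda>((a, c), (x, y)). ((x, y + c), (y, c))"])
           (auto simp: algebra_simps)
      also have "\<dots> = (\<Sum>p\<in>{(x, d). x + d = m}. \<Sum>r\<in>{(y, c). y + c = snd p}.
                    f (fst p) * (g (fst r) * h (snd r)))"
        by (subst sum.Sigma) (auto simp: finite_monom_splits[unfolded case_prod_unfold] case_prod_unfold)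
      also have "\<dots> = ?R"
        by (auto intro!: sum.cong simp: sum_distrib_left)
      finally show ?thesis .
    qed
    then show "(\<lambda>m. \<Sum>(a, c)\<in>{(a, c). a + c = m}.
                  (\<Sum>(x, y)\<in>{(x, y). x + y = a}. f x * g y) * h c)
        = (\<lambda>m. \<Sum>(x, d)\<in>{(x, d). x + d = m}.
                  f x * (\<Sum>(y, c)\<in>{(y, c). y + c = d}. g y * h c))"
      by blast
  qed
  show "f * g = g * f"
    by transfer (intro ext, rule sum.reindex_bij_witness[where i = prod.swap and j = prod.swap],
        auto simp: algebra_simps)
  show "1 * f = f"
  proof transfer
    fix f :: "(nat \<Rightarrow>\<^sub>0 nat) \<Rightarrow> 'a"
    have "(\<Sum>(a, b)\<in>{(a, b). a + b = m}. (if a = 0 then 1 else 0) * f b) = f m" for m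
    proof -
      have "(\<Sum>(a, b)\<in>{(a, b). a + b = m}. (if a = 0 then 1 else 0) * f b)
          = (\<Sum>(a, b)\<in>{(0 :: nat \<Rightarrow>\<^sub>0 nat, m)}. (if a = 0 then 1 else 0) * f b)"
        by (rule sum.mono_neutral_right) (auto simp: finite_monom_splits split: if_splits)
      then show ?thesis by simp
    qed
    then show "(\<lambda>m. \<Sum>(a, b)\<in>{(a, b). a + b = m}. (if a = 0 then 1 else 0) * f b) = f"
      by blast
  qed
  show "(f + g) * h = f * h + g * h"
    by transfer (auto simp: algebra_simps case_prod_unfold sum.distrib)
  show "(0 :: 'a mfps) \<noteq> 1"
    by transfer (auto dest: fun_cong[where x = 0])
qed (transfer; auto simp: algebra_simps)+

end

lift_definition mconst :: "'a::zero \<Rightarrow> 'a mfps" is "\<lambda>c m. if m = 0 then c else 0" .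

definition mdeg :: "(nat \<Rightarrow>\<^sub>0 nat) \<Rightarrow> nat"
  where "mdeg m = (\<Sum>i\<in>Poly_Mapping.keys m. Poly_Mapping.lookup m i)"


section \<open>The ground field $\mathbb{Q}(q,t)$\<close>

type_synonym qt = "rat poly poly fract"

definition q_var :: qt where "q_var = Fract [:[:0, 1:]:] 1"
definition t_var :: qt where "t_var = Fract [:0, 1:] 1"

definition subst_qt_poly :: "nat \<Rightarrow> rat poly poly \<Rightarrow> rat poly poly"
  where "subst_qt_poly k a = pcompose (map_poly (\<lambda>c. pcompose c (monom 1 k)) a) (monom 1 k)"

lemma subst_qt_poly_mult: "subst_qt_poly k (a * b) = subst_qt_poly k a * subst_qt_poly k b"
proof -
  let ?h = "\<lambda>c :: rat poly. pcompose c (monom 1 k)"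
  have "map_poly ?h (a * b) = map_poly ?h a * map_poly ?h b"
    by (rule poly_eqI) (simp add: coeff_map_poly coeff_mult pcompose_sum pcompose_mult)
  then show ?thesis by (simp add: subst_qt_poly_def pcompose_mult)
qed

lemma subst_qt_poly_eq_0_iff:
  assumes "k > 0" shows "subst_qt_poly k a = 0 \<longleftrightarrow> a = 0"
proof -
  have "degree (monom (1 :: rat) k) > 0" "degree (monom (1 :: rat poly) k) > 0"
    using assms by (simp_all add: degree_monom_eq)
  then show ?thesis
    by (auto simp: subst_qt_poly_def pcompose_eq_0_iff map_poly_eq_0_iff)
qed

text \<open>
  The endomorphism $q \mapsto q^k$, $t \mapsto t^k$ of $\mathbb{Q}(q,t)$, for $k \ge 1$.
\<close>

definition adams_qt :: "nat \<Rightarrow> qt \<Rightarrow> qt"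
  where "adams_qt k c = (THE d. \<exists>a b. b \<noteq> 0 \<and> c = Fract a b \<and>
    d = Fract (subst_qt_poly k a) (subst_qt_poly k b))"

lemma adams_qt_Fract:
  assumes "k > 0" "b \<noteq> 0"
  shows "adams_qt k (Fract a b) = Fract (subst_qt_poly k a) (subst_qt_poly k b)"
  unfolding adams_qt_def
proof (rule the_equality)
  fix d
  assume "\<exists>a' b'. b' \<noteq> 0 \<and> Fract a b = Fract a' b' \<and>
    d = Fract (subst_qt_poly k a') (subst_qt_poly k b')"
  then obtain a' b' where *: "b' \<noteq> 0" "Fract a b = Fract a' b'"
    and d: "d = Fract (subst_qt_poly k a') (subst_qt_poly k b')" by blast
  then have "a * b' = a' * b" using assms by (simp add: eq_fract)
  then have "subst_qt_poly k a * subst_qt_poly k b' = subst_qt_poly k a' * subst_qt_poly k b"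
    by (metis subst_qt_poly_mult)
  then show "d = Fract (subst_qt_poly k a) (subst_qt_poly k b)"
    using assms * by (simp add: d eq_fract subst_qt_poly_eq_0_iff)
qed (use assms in blast)

lemma adams_qt_q_var: "k > 0 \<Longrightarrow> adams_qt k q_var = q_var ^ k"
proof -
  assume k: "k > 0"
  have q: "q_var ^ n = Fract ([:[:0, 1:]:] ^ n) 1" for n
    by (induction n) (auto simp: q_var_def One_fract_def)
  have "[:[:0, 1:]:] ^ n = ([:[:0, 1:] ^ n:] :: rat poly poly)" for n
    by (induction n) (auto simp: one_pCons)
  then have "subst_qt_poly k [:[:0, 1:]:] = [:[:0, 1:]:] ^ k" "subst_qt_poly k 1 = 1"
    by (simp_all add: subst_qt_poly_def map_poly_pCons pcompose_pCons monom_altdef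
        map_poly_1' pcompose_1)
  with k q show ?thesis by (simp add: q_var_def adams_qt_Fract)
qed

lemma adams_qt_t_var: "k > 0 \<Longrightarrow> adams_qt k t_var = t_var ^ k"
proof -
  assume k: "k > 0"
  have t: "t_var ^ n = Fract ([:0, 1:] ^ n) 1" for n
    by (induction n) (auto simp: t_var_def One_fract_def)
  have "subst_qt_poly k [:0, 1:] = [:0, 1:] ^ k" "subst_qt_poly k 1 = 1"
    by (simp_all add: subst_qt_poly_def map_poly_pCons pcompose_pCons monom_altdef
        map_poly_1' pcompose_1)
  with k t show ?thesis by (simp add: t_var_def adams_qt_Fract)
qed

definition M_qt :: qt where "M_qt = (1 - t_var) * (1 - q_var)"
definition M_tilde :: qt where "M_tilde = (1 - 1 / t_var) * (1 - 1 / q_var)"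


section \<open>Symmetric functions\<close>

text \<open>Formal power series of bounded degree, invariant under permutations of the variables.\<close>

definition symfun :: "qt mfps set"
  where "symfun = {f. (\<exists>d. \<forall>m. mfps_nth f m \<noteq> 0 \<longrightarrow> mdeg m \<le> d) \<and>
    (\<forall>\<pi>. bij \<pi> \<longrightarrow> (\<forall>m. mfps_nth f (Poly_Mapping.map_key \<pi> m) = mfps_nth f m))}"

text \<open>The alphabet $X = x_0 + x_1 + \cdots$.\<close>

definition X_alph :: "qt mfps"
  where "X_alph = Abs_mfps (\<lambda>m. if mdeg m = 1 then 1 else 0)"

definition h_sym :: "nat \<Rightarrow> qt mfps"
  where "h_sym n = Abs_mfps (\<lambda>m. if mdeg m = n then 1 else 0)"


section \<open>Plethysm\<close>

text \<open>
  \<open>adams k E\<close> and \<open>adamsz k E\<close> are $p_k[E]$ for $k \ge 1$: every variable, including $q$, $t$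
  and, for \<open>adamsz\<close>, the Laurent series variable $z$, is raised to the $k$-th power.
\<close>

definition adams :: "nat \<Rightarrow> qt mfps \<Rightarrow> qt mfps"
  where "adams k E = Abs_mfps (\<lambda>m. if \<forall>i. k dvd Poly_Mapping.lookup m i
    then adams_qt k (mfps_nth E (Poly_Mapping.map (\<lambda>e. e div k) m)) else 0)"

definition adamsz :: "nat \<Rightarrow> qt mfps fls \<Rightarrow> qt mfps fls"
  where "adamsz k E =
    Abs_fls (\<lambda>n. if int k dvd n then adams k (fls_nth E (n div int k)) else 0)"

lemma fls_nth_adamsz:
  assumes "k > 0"
  shows "fls_nth (adamsz k E) n = (if int k dvd n then adams k (fls_nth E (n div int k)) else 0)"
proof -
  have "adams_qt k 0 = 0"
    using assms adams_qt_Fract[of k 1 0]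
    by (simp add: Zero_fract_def[symmetric] subst_qt_poly_def fract_collapse)
  then have [simp]: "adams k 0 = 0"
    by (intro mfps_eqI) (simp add: adams_def Abs_mfps_inverse zero_mfps.rep_eq)
  have "(if int k dvd m then adams k (fls_nth E (m div int k)) else 0) = 0"
    if "m < int k * fls_subdegree E" for m
    using that assms by (auto simp: mult_less_cancel_left)
  then show ?thesis
    unfolding adamsz_def by (intro nth_Abs_fls_lower_bound) blast
qed

text \<open>
  A polynomial in the power sums is an element of \<^typ>\<open>(nat \<Rightarrow>\<^sub>0 nat) \<Rightarrow>\<^sub>0 qt\<close> in which the
  variable with index \<open>i\<close> stands for $p_{i+1}$. The map \<open>c\<close> embeds the scalars in the target ring.
\<close>

definition psubst :: "(qt \<Rightarrow> 'r::comm_ring_1) \<Rightarrow> (nat \<Rightarrow> 'r) \<Rightarrow> ((nat \<Rightarrow>\<^sub>0 nat) \<Rightarrow>\<^sub>0 qt) \<Rightarrow> 'r"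
  where "psubst c p P = (\<Sum>m\<in>Poly_Mapping.keys P. c (Poly_Mapping.lookup P m) *
    (\<Prod>i\<in>Poly_Mapping.keys m. p (Suc i) ^ Poly_Mapping.lookup m i))"

definition psum_expansion :: "qt mfps \<Rightarrow> ((nat \<Rightarrow>\<^sub>0 nat) \<Rightarrow>\<^sub>0 qt)"
  where "psum_expansion F = (THE P. psubst mconst (\<lambda>k. adams k X_alph) P = F)"

definition pleth :: "qt mfps \<Rightarrow> qt mfps \<Rightarrow> qt mfps"
  where "pleth F E = psubst mconst (\<lambda>k. adams k E) (psum_expansion F)"

abbreviation scalz :: "qt \<Rightarrow> qt mfps fls"
  where "scalz c \<equiv> fls_const (mconst c)"

definition plethz :: "qt mfps \<Rightarrow> qt mfps fls \<Rightarrow> qt mfps fls"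
  where "plethz F E = psubst scalz (\<lambda>k. adamsz k E) (psum_expansion F)"

text \<open>
  $\Omega[E] = \exp\bigl(\sum_{k \ge 1} p_k[E]/k\bigr)$; both infinite sums are taken in the
  $z$-adic topology, so the definition is meaningful for $E$ without terms of order $\le 0$ in $z$.
\<close>

definition Omega :: "qt mfps fls \<Rightarrow> qt mfps fls"
  where "Omega E = suminf (\<lambda>n. scalz (1 / of_nat (fact n)) *
    suminf (\<lambda>k. scalz (1 / of_nat (Suc k)) * adamsz (Suc k) E) ^ n)"


section \<open>The operators $D_k$ and $D_k^*$\<close>

definition D_op :: "int \<Rightarrow> qt mfps \<Rightarrow> qt mfps"
  where "D_op k F = fls_nth
    (plethz F (fls_const X_alph + scalz M_qt * fls_X_inv) * Omega (- (fls_X * fls_const X_alph))) k"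

definition D_star :: "int \<Rightarrow> qt mfps \<Rightarrow> qt mfps"
  where "D_star k F = fls_nth
    (plethz F (fls_const X_alph - scalz M_tilde * fls_X_inv) * Omega (fls_X * fls_const X_alph)) k"

end

theory Submission
  imports Defs
begin

text \<open>
  Multiplication by $p_k$ satisfies $D_a p_k = p_k D_a + p_k[M] D_{a+k}$ and
  $D_b^* p_k = p_k D_b^* - p_k[\widetilde M] D_{b+k}^*$. Since $p_k[M] = (qt)^k p_k[\widetilde M]$,
  both sides of the identity therefore transform in the same way under $F \mapsto p_k F$, and as the
  power sums generate the symmetric functions it suffices to treat $F = 1$. There the commutator is
  $\sum_{i+j=a+b} c_{i-a}\, h_i[-X]\, h_j[X]$, where $c_n$ is the difference of the coefficients of
  $u^n$ in the expansions of $\frac{(1-tu)(1-qu)}{(1-u)(1-qtu)}$ at $u = 0$ and $u = \infty$, that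
  is $c_n = \frac{M}{qt-1}((qt)^n - 1)$. The constant part contributes $h_{a+b}[X - X] = 0$ and the
  geometric part is the right-hand side.
\<close>

text \<open>\<open>plethz\<close> goes through \<open>psum_expansion\<close>, a definite
  description, so it can be computed only once the power sums are known to be algebraically
  independent and to generate. \<open>Omega\<close> is a nested infinite sum; it is replaced by a
  series satisfying Newton's identities, and later equalities of exponentials follow from uniqueness
  for these. Why the two sides transform alike: the right-hand side is a multiplication operator, so
  it commutes with p_k. In the commutator, p_k[M] comes with the indices (a+k, b) and p_k[M~] with
  (a, b+k), where M~ is \<open>M_tilde\<close>. Both give the same h_{a+b+k}, and the powers (qt)^b
  and (qt)^(b+k) differ by exactly the ratio p_k[M] / p_k[M~], so the extra terms cancel. Why one
  rational function has two expansions: for F = 1 one order of the operators produces Omega[uM], the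
  other Omega[M~/u]. Inverting the monomials of M changes each factor 1 - xu only by a monomial, and
  these monomials cancel because the product of 1 and qt equals that of q and t. The condition a+b >
  0 enters through h_{a+b}[X-X], which is 1 at a+b = 0.\<close>

abbreviation lookup where "lookup \<equiv> Poly_Mapping.lookup"
abbreviation keys where "keys \<equiv> Poly_Mapping.keys"
abbreviation single where "single \<equiv> Poly_Mapping.single"

section \<open>Monomials\<close>

lemma poly_mapping_single_induct [case_names zero single]:
  assumes "P 0"
    and "\<And>f a b. a \<notin> keys f \<Longrightarrow> b \<noteq> 0 \<Longrightarrow> P f \<Longrightarrow> P (single a b + f)"
  shows "P (f :: 'a \<Rightarrow>\<^sub>0 'b :: comm_monoid_add)"
proof (induction f rule: Poly_Mapping.update_induct)
  case (update f a b)
  have "Poly_Mapping.update a b f = single a b + f"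
    using update(1) by (intro poly_mapping_eqI)
      (auto simp: lookup_update lookup_add lookup_single in_keys_iff when_def)
  then show ?case using assms(2) update by simp
qed (fact assms(1))

lemma mdeg_0 [simp]: "mdeg 0 = 0"
  by (simp add: mdeg_def)

lemma mdeg_single [simp]: "mdeg (single i n) = n"
  by (cases "n = 0") (simp_all add: mdeg_def)

lemma mdeg_add: "mdeg (m + n) = mdeg m + mdeg n"
  unfolding mdeg_def by (rule setsum_keys_plus_distrib) auto

lemma mdeg_eq_0_iff: "mdeg m = 0 \<longleftrightarrow> m = 0"
proof
  assume "mdeg m = 0"
  then show "m = 0" by (intro poly_mapping_eqI) (auto simp: mdeg_def in_keys_iff)
qed simp

lemma monom_split:
  fixes m :: "nat \<Rightarrow>\<^sub>0 nat"
  assumes "k \<le> lookup m j"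
  shows "m = single j k + (m - single j k)"
  using assms by (intro poly_mapping_eqI) (auto simp: lookup_add lookup_minus lookup_single when_def)

text \<open>Exponents grow by one at a time, so for monomials in the power sums each step is
  multiplication by a single p_k.\<close>

lemma monom_induct [case_names zero add]:
  assumes "P 0" and "\<And>i m. P m \<Longrightarrow> P (single i 1 + m)"
  shows "P (m :: nat \<Rightarrow>\<^sub>0 nat)"
proof (induction "mdeg m" arbitrary: m)
  case 0
  then show ?case using assms(1) by (simp add: mdeg_eq_0_iff)
next
  case (Suc d)
  then have "m \<noteq> 0" by auto
  then obtain i where "lookup m i \<noteq> 0" by (metis keys_eq_empty in_keys_iff ex_in_conv)
  then have m: "m = single i 1 + (m - single i 1)" by (intro monom_split) auto
  then have "mdeg m = 1 + mdeg (m - single i 1)" by (metis mdeg_add mdeg_single)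
  with Suc have "P (m - single i 1)" by simp
  with assms(2) m show ?case by metis
qed

lemma mdeg_eq_1_iff: "mdeg m = 1 \<longleftrightarrow> (\<exists>j. m = single j 1)"
proof
  assume "mdeg m = 1"
  then show "\<exists>j. m = single j 1"
    by (induction m rule: monom_induct) (auto simp: mdeg_add mdeg_eq_0_iff)
qed auto

lemma card_keys_le_mdeg: "card (keys m) \<le> mdeg m"
proof -
  have "(\<Sum>i\<in>keys m. 1) \<le> (\<Sum>i\<in>keys m. lookup m i)"
    by (intro sum_mono) (simp add: in_keys_iff Suc_leI)
  then show ?thesis by (simp add: mdeg_def)
qed

lemma lookup_le_mdeg: "lookup m i \<le> mdeg m"
proof (cases "i \<in> keys m")
  case True
  then show ?thesis unfolding mdeg_def by (intro member_le_sum) auto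
qed (simp add: in_keys_iff)

text \<open>Source of the triangularity: read backwards, multiplication by p_k either enlarges an
  existing exponent or introduces a new variable with exponent exactly k, and only the latter adds a
  part.\<close>

lemma card_keys_remove:
  fixes m :: "nat \<Rightarrow>\<^sub>0 nat"
  assumes "0 < k" "k \<le> lookup m j"
  shows "card (keys m) \<le> Suc (card (keys (m - single j k)))"
    and "card (keys m) = Suc (card (keys (m - single j k))) \<longleftrightarrow> lookup m j = k"
proof -
  let ?m = "m - single j k"
  have j: "j \<in> keys m" using assms by (auto simp: in_keys_iff)
  have *: "keys ?m = (if lookup m j = k then keys m - {j} else keys m)"
    using assms by (auto simp: in_keys_iff lookup_minus lookup_single when_def split: if_splits)
  have "Suc (card (keys m - {j})) = card (keys m)"
    using j by (intro card_Suc_Diff1) simp_all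
  then show "card (keys m) \<le> Suc (card (keys ?m))"
    "card (keys m) = Suc (card (keys ?m)) \<longleftrightarrow> lookup m j = k"
    unfolding * by presburger+
qed

text \<open>
  The partition underlying an exponent vector, encoded like the monomials in the power sums:
  the entry with index \<open>i\<close> is the multiplicity of the part \<open>i + 1\<close>.
\<close>

definition part_type :: "(nat \<Rightarrow>\<^sub>0 nat) \<Rightarrow> (nat \<Rightarrow>\<^sub>0 nat)"
  where "part_type m = (\<Sum>j\<in>keys m. single (lookup m j - 1) 1)"

lemma lookup_part_type: "lookup (part_type m) i = card {j. lookup m j = Suc i}"
proof -
  have "lookup (part_type m) i = (\<Sum>j\<in>keys m. if lookup m j = Suc i then 1 else 0)"
    unfolding part_type_def lookup_sum
    by (intro sum.cong) (auto simp: lookup_single when_def in_keys_iff)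
  also have "\<dots> = card {j\<in>keys m. lookup m j = Suc i}"
    by (simp add: sum.If_cases Int_def)
  also have "{j\<in>keys m. lookup m j = Suc i} = {j. lookup m j = Suc i}"
    by (auto simp: in_keys_iff)
  finally show ?thesis .
qed

lemma mdeg_sum: "mdeg (\<Sum>x\<in>A. f x) = (\<Sum>x\<in>A. mdeg (f x))"
  by (induction A rule: infinite_finite_induct) (auto simp: mdeg_add)

lemma mdeg_part_type: "mdeg (part_type m) = card (keys m)"
  by (simp add: part_type_def mdeg_sum)

lemma part_type_remove:
  assumes "lookup m j = Suc i"
  shows "part_type m = single i 1 + part_type (m - single j (Suc i))"
proof -
  let ?m = "m - single j (Suc i)"
  have j: "j \<in> keys m" using assms by (auto simp: in_keys_iff)
  have k: "keys ?m = keys m - {j}"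
    using assms by (auto simp: in_keys_iff lookup_minus lookup_single when_def split: if_splits)
  have "part_type m = single i 1 + (\<Sum>l\<in>keys m - {j}. single (lookup m l - 1) 1)"
    unfolding part_type_def using j assms by (simp add: sum.remove)
  also have "(\<Sum>l\<in>keys m - {j}. single (lookup m l - 1) 1) = part_type ?m"
    unfolding part_type_def k
    by (intro sum.cong) (auto simp: lookup_minus lookup_single when_def)
  finally show ?thesis .
qed

text \<open>The permutation is glued from bijections between the level sets of the two exponent
  vectors. Positive levels are finite of equal size; level 0 is infinite because supports are
  finite, and is matched by enumeration.\<close>

lemma part_type_eq_imp_permuted:
  assumes "part_type m = part_type n"
  obtains \<pi> where "bij \<pi>" "Poly_Mapping.map_key \<pi> m = n"
proof -
  have "\<exists>f. bij_betw f {j. lookup n j = v} {j. lookup m j = v}" for v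
  proof (cases v)
    case 0
    have inf: "infinite {j. lookup k j = 0}" for k :: "nat \<Rightarrow>\<^sub>0 nat"
    proof -
      have "{j. lookup k j = 0} = - keys k" by (auto simp: in_keys_iff)
      then show ?thesis by (metis finite_keys finite_Diff2 Compl_eq_Diff_UNIV infinite_UNIV_nat)
    qed
    have "bij_betw (enumerate {j. lookup m j = 0} \<circ> inv_into UNIV (enumerate {j. lookup n j = 0}))
        {j. lookup n j = 0} {j. lookup m j = 0}"
      by (rule bij_betw_trans[OF bij_betw_inv_into[OF bij_enumerate[OF inf]] bij_enumerate[OF inf]])
    then show ?thesis using 0 by blast
  next
    case (Suc i)
    have fin: "finite {j. lookup k j = Suc i}" for k :: "nat \<Rightarrow>\<^sub>0 nat"
      by (rule finite_subset[OF _ finite_keys[of k]]) (auto simp: in_keys_iff)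
    have "card {j. lookup n j = Suc i} = card {j. lookup m j = Suc i}"
      using assms by (metis lookup_part_type)
    then show ?thesis using Suc fin finite_same_card_bij by blast
  qed
  then obtain f where f: "bij_betw (f v) {j. lookup n j = v} {j. lookup m j = v}" for v by metis
  define \<pi> where "\<pi> j = f (lookup n j) j" for j
  have l: "lookup m (\<pi> j) = lookup n j" for j
    using f[of "lookup n j"] by (auto simp: \<pi>_def bij_betw_def)
  have "inj \<pi>"
  proof (rule injI)
    fix x y assume eq: "\<pi> x = \<pi> y"
    then have "lookup n x = lookup n y" using l by metis
    with eq f[of "lookup n x"] show "x = y"
      by (auto simp: \<pi>_def bij_betw_def inj_on_def)
  qed
  moreover have "surj \<pi>"
  proof (rule surjI)
    fix y
    let ?g = "\<lambda>y. inv_into {j. lookup n j = lookup m y} (f (lookup m y)) y"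
    have y: "y \<in> f (lookup m y) ` {j. lookup n j = lookup m y}"
      using f[of "lookup m y"] by (simp add: bij_betw_def)
    have "?g y \<in> {j. lookup n j = lookup m y}" "f (lookup m y) (?g y) = y"
      using inv_into_into[OF y] f_inv_into_f[OF y] by simp_all
    then show "\<pi> (?g y) = y" by (simp add: \<pi>_def)
  qed
  ultimately have "bij \<pi>" by (simp add: bij_def)
  moreover have "Poly_Mapping.map_key \<pi> m = n"
    using \<open>inj \<pi>\<close> l by (intro poly_mapping_eqI) (simp add: map_key.rep_eq)
  ultimately show ?thesis using that by blast
qed

lemma inj_single: "0 < k \<Longrightarrow> inj (\<lambda>j. single j (k :: nat))"
  by (metis (mono_tags, lifting) injI keys_single less_irrefl singleton_inject)

text \<open>A further part is realised by giving its size as exponent to a variable outside the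
  finite support.\<close>

lemma part_type_surj: "\<exists>m. part_type m = l"
proof (induction l rule: monom_induct)
  case zero
  show ?case by (intro exI[of _ 0]) (simp add: part_type_def)
next
  case (add i l)
  then obtain m where m: "part_type m = l" by blast
  obtain j where j: "j \<notin> keys m" by (meson finite_keys ex_new_if_finite infinite_UNIV_nat)
  let ?m = "single j (Suc i) + m"
  have "lookup ?m j = Suc i" using j by (simp add: lookup_add in_keys_iff)
  then have "part_type ?m = single i 1 + part_type (?m - single j (Suc i))"
    by (rule part_type_remove)
  then show ?case using m by (metis add_diff_cancel_left')
qed


section \<open>Coefficients of series\<close>

lemma mfps_nth_simps [simp]:
  fixes f g :: "'a :: comm_ring_1 mfps"
  shows "mfps_nth 0 m = (0 :: 'a)"
    and "mfps_nth (f + g) m = mfps_nth f m + mfps_nth g m"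
    and "mfps_nth (f - g) m = mfps_nth f m - mfps_nth g m"
    and "mfps_nth (- f) m = - mfps_nth f m"
  by (transfer; simp)+

lemma mfps_nth_1: "mfps_nth (1 :: 'a :: comm_ring_1 mfps) m = (if m = 0 then 1 else 0)"
  by transfer simp

lemma mfps_nth_mconst: "mfps_nth (mconst c) m = (if m = 0 then c else 0)"
  by transfer simp

lemma mfps_nth_Abs [simp]: "mfps_nth (Abs_mfps f) = f"
  by (simp add: Abs_mfps_inverse)

lemma mfps_nth_sum: "mfps_nth (\<Sum>x\<in>A. f x) m = (\<Sum>x\<in>A. mfps_nth (f x) m :: 'a :: comm_ring_1)"
  by (induction A rule: infinite_finite_induct) auto

lemma mfps_nth_mconst_mult [simp]:
  fixes f :: "'a :: comm_ring_1 mfps"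
  shows "mfps_nth (mconst c * f) m = c * mfps_nth f m"
proof -
  have "mfps_nth (mconst c * f) m
      = (\<Sum>(a, b)\<in>{(a, b). a + b = m}. mfps_nth (mconst c) a * mfps_nth f b)"
    by (simp add: times_mfps.rep_eq)
  also have "\<dots> = (\<Sum>(a, b)\<in>{(0, m)}. mfps_nth (mconst c) a * mfps_nth f b)"
    by (rule sum.mono_neutral_right)
      (auto simp: finite_monom_splits mfps_nth_mconst split: if_splits)
  finally show ?thesis by (simp add: mfps_nth_mconst)
qed

lemma mconst_0 [simp]: "mconst 0 = (0 :: 'a :: comm_ring_1 mfps)"
  and mconst_1 [simp]: "mconst 1 = (1 :: 'a :: comm_ring_1 mfps)"
  by (rule mfps_eqI, simp add: mfps_nth_mconst mfps_nth_1)+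

lemma mconst_add: "mconst (c + d) = mconst c + (mconst d :: 'a :: comm_ring_1 mfps)"
  and mconst_diff: "mconst (c - d) = mconst c - (mconst d :: 'a :: comm_ring_1 mfps)"
  and mconst_minus: "mconst (- c) = - (mconst c :: 'a :: comm_ring_1 mfps)"
  and mconst_mult: "mconst (c * d) = mconst c * (mconst d :: 'a :: comm_ring_1 mfps)"
  by (rule mfps_eqI, simp add: mfps_nth_mconst)+

lemma mfps_nth_of_nat_mult [simp]:
  "mfps_nth (of_nat n * f) m = of_nat n * (mfps_nth f m :: 'a :: comm_ring_1)"
  by (induction n) (auto simp: algebra_simps)


section \<open>Adams operations\<close>

lemma subst_qt_poly_1: "subst_qt_poly k 1 = 1"
  by (simp add: subst_qt_poly_def map_poly_1' pcompose_1)

lemma subst_qt_poly_0: "subst_qt_poly k 0 = 0"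
  by (simp add: subst_qt_poly_def)

lemma subst_qt_poly_add: "subst_qt_poly k (a + b) = subst_qt_poly k a + subst_qt_poly k b"
proof -
  let ?h = "\<lambda>c :: rat poly. pcompose c (monom 1 k)"
  have "map_poly ?h (a + b) = map_poly ?h a + map_poly ?h b"
    by (rule poly_eqI) (simp add: coeff_map_poly pcompose_add)
  then show ?thesis by (simp add: subst_qt_poly_def pcompose_add)
qed

context
  fixes k :: nat
  assumes k: "k > 0"
begin

lemma adams_qt_0: "adams_qt k 0 = 0"
  using adams_qt_Fract[OF k, of 1 0]
  by (simp add: Zero_fract_def subst_qt_poly_1 subst_qt_poly_0)

lemma adams_qt_1: "adams_qt k 1 = 1"
  using adams_qt_Fract[OF k, of 1 1] by (simp add: One_fract_def subst_qt_poly_1)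

lemma adams_qt_mult: "adams_qt k (c * d) = adams_qt k c * adams_qt k d"
  by (cases c, cases d)
    (simp add: adams_qt_Fract k subst_qt_poly_mult subst_qt_poly_eq_0_iff)

lemma adams_qt_add: "adams_qt k (c + d) = adams_qt k c + adams_qt k d"
  by (cases c, cases d)
    (simp add: adams_qt_Fract k subst_qt_poly_mult subst_qt_poly_add subst_qt_poly_eq_0_iff)

lemma adams_qt_uminus: "adams_qt k (- c) = - adams_qt k c"
  by (metis adams_qt_add adams_qt_0 add_eq_0_iff add.right_inverse)

lemma adams_qt_diff: "adams_qt k (c - d) = adams_qt k c - adams_qt k d"
  using adams_qt_add[of c "- d"] by (simp add: adams_qt_uminus)

lemma adams_qt_divide: "adams_qt k (c / d) = adams_qt k c / adams_qt k d"
proof (cases "d = 0")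
  case False
  have "adams_qt k (c / d) * adams_qt k d = adams_qt k c"
    using False by (simp flip: adams_qt_mult)
  moreover have "adams_qt k d * adams_qt k (1 / d) = 1"
    using False by (simp add: adams_qt_1 flip: adams_qt_mult)
  then have "adams_qt k d \<noteq> 0" by auto
  ultimately show ?thesis by (simp add: field_simps)
qed (simp add: adams_qt_0)

lemma adams_0 [simp]: "adams k 0 = 0"
  by (rule mfps_eqI) (simp add: adams_def adams_qt_0)

lemma adams_uminus: "adams k (- E) = - adams k E"
  by (rule mfps_eqI) (simp add: adams_def adams_qt_uminus)

lemma adams_mconst_mult: "adams k (mconst c * E) = mconst (adams_qt k c) * adams k E"
  by (rule mfps_eqI) (simp add: adams_def adams_qt_mult)

lemma adams_mconst: "adams k (mconst c) = mconst (adams_qt k c)"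
proof -
  have "adams k 1 = 1"
  proof (rule mfps_eqI)
    fix m :: "nat \<Rightarrow>\<^sub>0 nat"
    \<comment> \<open>Division by k can send nonzero exponents to 0; divisibility of all exponents
      excludes this.\<close>
    have "Poly_Mapping.map (\<lambda>e. e div k) m = 0 \<longleftrightarrow> m = 0" if "\<forall>i. k dvd lookup m i"
    proof
      assume *: "Poly_Mapping.map (\<lambda>e. e div k) m = 0"
      have "lookup m i = 0" for i
      proof -
        have "lookup m i div k = 0"
          using arg_cong[OF *, of "\<lambda>m. lookup m i"] by (simp add: map.rep_eq when_def split: if_splits)
        then show ?thesis using that k by (metis dvd_div_eq_0_iff)
      qed
      then show "m = 0" by (intro poly_mapping_eqI) simp
    qed (auto intro!: poly_mapping_eqI simp: map.rep_eq)
    then show "mfps_nth (adams k 1) m = mfps_nth 1 m"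
      by (auto simp: adams_def mfps_nth_1 adams_qt_1 adams_qt_0)
  qed
  then show ?thesis using adams_mconst_mult[of c 1] by simp
qed

text \<open>Confirms that p_k[X] is the usual power sum, the sum of the k-th powers of the
  variables.\<close>

lemma mfps_nth_adams_X: "mfps_nth (adams k X_alph) m = (if \<exists>j. m = single j k then 1 else 0)"
proof -
  have "(\<forall>i. k dvd lookup m i) \<and> (\<exists>j. Poly_Mapping.map (\<lambda>e. e div k) m = single j 1)
      \<longleftrightarrow> (\<exists>j. m = single j k)"
  proof safe
    fix j assume *: "\<forall>i. k dvd lookup m i" "Poly_Mapping.map (\<lambda>e. e div k) m = single j 1"
    have "lookup m i = lookup (single j k) i" for i
    proof -
      have "lookup m i div k = (if i = j then 1 else 0)"
        using arg_cong[OF *(2), of "\<lambda>m. lookup m i"]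
        by (auto simp: map.rep_eq lookup_single when_def split: if_splits)
      then have "lookup m i = k * (if i = j then 1 else 0)"
        using *(1) by (metis dvd_mult_div_cancel)
      then show ?thesis by (simp add: lookup_single when_def)
    qed
    then have "m = single j k" by (intro poly_mapping_eqI) auto
    then show "\<exists>j. m = single j k" by blast
  next
    fix j assume "m = single j k"
    then have "Poly_Mapping.map (\<lambda>e. e div k) (single j k) = single j 1"
      using k by (intro poly_mapping_eqI) (auto simp: map.rep_eq lookup_single when_def)
    then show "\<exists>l. Poly_Mapping.map (\<lambda>e. e div k) (single j k) = single l 1" by blast
  qed (simp add: lookup_single when_def)
  then show ?thesis
    unfolding adams_def X_alph_def mdeg_eq_1_iff mfps_nth_Abs using adams_qt_1 adams_qt_0 by auto
qed

lemma mfps_nth_adams_X_mult: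
  "mfps_nth (adams k X_alph * f) m = (\<Sum>j | k \<le> lookup m j. mfps_nth f (m - single j k))"
proof -
  have fin: "finite {j. k \<le> lookup m j}"
    by (rule finite_subset[OF _ finite_keys[of m]]) (use k in \<open>auto simp: in_keys_iff\<close>)
  let ?g = "\<lambda>j. (single j k, m - single j k)"
  have "mfps_nth (adams k X_alph * f) m
      = (\<Sum>(a, b)\<in>{(a, b). a + b = m}. mfps_nth (adams k X_alph) a * mfps_nth f b)"
    by (simp add: times_mfps.rep_eq)
  \<comment> \<open>Only factorizations whose first factor is x_j^k contribute. Subtraction of
    exponents is truncated, so the condition \<open>k \<le> lookup m j\<close> is what makes x_j^k a
    divisor.\<close>
  also have "\<dots> = (\<Sum>(a, b)\<in>?g ` {j. k \<le> lookup m j}. mfps_nth (adams k X_alph) a * mfps_nth f b)"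
  proof (rule sum.mono_neutral_right)
    show "?g ` {j. k \<le> lookup m j} \<subseteq> {(a, b). a + b = m}"
    proof clarify
      fix j assume "k \<le> lookup m j"
      then show "single j k + (m - single j k) = m" by (rule monom_split[symmetric])
    qed
    show "\<forall>i\<in>{(a, b). a + b = m} - ?g ` {j. k \<le> lookup m j}.
        (case i of (a, b) \<Rightarrow> mfps_nth (adams k X_alph) a * mfps_nth f b) = 0"
    proof
      fix x assume x: "x \<in> {(a, b). a + b = m} - ?g ` {j. k \<le> lookup m j}"
      obtain a b where ab: "x = (a, b)" by (cases x)
      with x have m: "m = a + b" by simp
      have "a \<noteq> single j k" for j
      proof
        assume "a = single j k"
        then have "x = ?g j" "k \<le> lookup m j" by (simp_all add: m ab lookup_add)
        with x show False by blast
      qed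
      then show "(case x of (a, b) \<Rightarrow> mfps_nth (adams k X_alph) a * mfps_nth f b) = 0"
        by (simp add: ab mfps_nth_adams_X)
    qed
  qed (rule finite_monom_splits)
  also have "\<dots> = (\<Sum>j | k \<le> lookup m j. mfps_nth f (m - single j k))"
    using inj_single[OF k]
    by (subst sum.reindex) (auto simp: inj_on_def mfps_nth_adams_X intro!: sum.cong)
  finally show ?thesis .
qed

end


section \<open>Polynomials in the power sums\<close>

definition pmon :: "(nat \<Rightarrow> 'r::comm_ring_1) \<Rightarrow> (nat \<Rightarrow>\<^sub>0 nat) \<Rightarrow> 'r"
  where "pmon p m = (\<Prod>i\<in>keys m. p (Suc i) ^ lookup m i)"

lemma pmon_0 [simp]: "pmon p 0 = 1"
  by (simp add: pmon_def)

lemma pmon_superset: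
  assumes "finite A" "keys m \<subseteq> A"
  shows "pmon p m = (\<Prod>i\<in>A. p (Suc i) ^ lookup m i)"
  unfolding pmon_def using assms by (intro prod.mono_neutral_left) (auto simp: in_keys_iff)

lemma pmon_add: "pmon p (m + n) = pmon p m * pmon p n"
proof -
  let ?A = "keys m \<union> keys n"
  have "keys (m + n) \<subseteq> ?A" by (rule keys_add)
  then show ?thesis
    using pmon_superset[of ?A "m + n" p] pmon_superset[of ?A m p] pmon_superset[of ?A n p]
    by (simp add: lookup_add power_add prod.distrib)
qed

lemma pmon_single [simp]: "pmon p (single i 1) = p (Suc i)"
  by (simp add: pmon_def)

text \<open>Abstracts from the embeddings \<open>mconst\<close> and \<open>scalz\<close>, so that
  evaluation in symmetric functions and in Laurent series over them is treated once.\<close>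

definition scalar_hom :: "(qt \<Rightarrow> 'r::comm_ring_1) \<Rightarrow> bool"
  where "scalar_hom c \<longleftrightarrow> c 0 = 0 \<and> c 1 = 1 \<and> (\<forall>x y. c (x + y) = c x + c y) \<and>
    (\<forall>x y. c (x * y) = c x * c y)"

lemma scalar_hom_mconst: "scalar_hom mconst"
  by (simp add: scalar_hom_def mconst_add mconst_mult)

lemma scalar_hom_scalz: "scalar_hom scalz"
  by (simp add: scalar_hom_def mconst_add mconst_mult fls_plus_const fls_const_mult_const)

context
  fixes c :: "qt \<Rightarrow> 'r::comm_ring_1"
  assumes c: "scalar_hom c"
begin

lemma psubst_0 [simp]: "psubst c p 0 = 0"
  by (simp add: psubst_def)

lemma psubst_single: "psubst c p (single m a) = c a * pmon p m"
  using c by (cases "a = 0") (simp_all add: psubst_def pmon_def scalar_hom_def)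

lemma psubst_add: "psubst c p (P + Q) = psubst c p P + psubst c p Q"
  unfolding psubst_def
  by (rule setsum_keys_plus_distrib) (use c in \<open>auto simp: scalar_hom_def algebra_simps\<close>)

lemma psubst_single_mult: "psubst c p (single m a * P) = c a * pmon p m * psubst c p P"
proof (induction P rule: poly_mapping_single_induct)
  case (single P n b)
  have "single m a * (single n b + P) = single (m + n) (a * b) + single m a * P"
    by (simp add: distrib_left mult_single)
  then show ?case
    using single c by (simp add: psubst_add psubst_single pmon_add scalar_hom_def algebra_simps)
qed simp

end

section \<open>The subring generated by the power sums\<close>

abbreviation psum :: "nat \<Rightarrow> qt mfps"
  where "psum k \<equiv> adams k X_alph"

definition psum_eval :: "((nat \<Rightarrow>\<^sub>0 nat) \<Rightarrow>\<^sub>0 qt) \<Rightarrow> qt mfps"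
  where "psum_eval = psubst mconst psum"

text \<open>Range membership is carried along in the cases because linearity of the plethystic
  operators is available only where \<open>psum_expansion\<close> is known to invert
  \<open>psum_eval\<close>.\<close>

lemma psum_eval_range_induct [consumes 1, case_names const add psum]:
  assumes "F \<in> range psum_eval"
    and "\<And>c. Q (mconst c)"
    and "\<And>F G. F \<in> range psum_eval \<Longrightarrow> G \<in> range psum_eval \<Longrightarrow> Q F \<Longrightarrow> Q G \<Longrightarrow> Q (F + G)"
    and "\<And>k F. k > 0 \<Longrightarrow> F \<in> range psum_eval \<Longrightarrow> Q F \<Longrightarrow> Q (psum k * F)"
  shows "Q F"
proof -
  have *: "Q (psum_eval (single m a))" for m a
  proof (induction m rule: monom_induct)
    case zero
    then show ?case
      using assms(2) by (simp add: psum_eval_def psubst_single[OF scalar_hom_mconst])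
  next
    case (add i m)
    have "psum_eval (single (single i 1 + m) a) = psum (Suc i) * psum_eval (single m a)"
      by (simp add: psum_eval_def psubst_single[OF scalar_hom_mconst] pmon_add
          pmon_single[simplified] mult_ac)
    then show ?case using assms(4) add by simp
  qed
  have "Q (psum_eval P)" for P
  proof (induction P rule: poly_mapping_single_induct)
    case zero
    then show ?case
      using assms(2)[of 0] by (simp add: psum_eval_def psubst_0[OF scalar_hom_mconst])
  next
    case (single P m a)
    then show ?case
      using assms(3) * by (simp add: psum_eval_def psubst_add[OF scalar_hom_mconst])
  qed
  then show ?thesis using assms(1) by auto
qed

lemma psum_eval_add: "psum_eval (P + Q) = psum_eval P + psum_eval Q"
  by (simp add: psum_eval_def psubst_add[OF scalar_hom_mconst])

lemma psum_eval_const_mult: "psum_eval (single 0 a * P) = mconst a * psum_eval P"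
  by (simp add: psum_eval_def psubst_single_mult[OF scalar_hom_mconst])

lemma psum_eval_psum_mult: "k > 0 \<Longrightarrow> psum_eval (single (single (k - 1) 1) 1 * P) = psum k * psum_eval P"
  using pmon_single[of psum "k - 1"]
  by (simp add: psum_eval_def psubst_single_mult[OF scalar_hom_mconst])

lemma psum_eval_0: "psum_eval 0 = 0"
  by (simp add: psum_eval_def psubst_0[OF scalar_hom_mconst])

lemma psum_eval_const: "psum_eval (single 0 a) = mconst a"
  by (simp add: psum_eval_def psubst_single[OF scalar_hom_mconst])

lemma range_psum_eval_add:
  "F \<in> range psum_eval \<Longrightarrow> G \<in> range psum_eval \<Longrightarrow> F + G \<in> range psum_eval"
  by (auto simp flip: psum_eval_add)

lemma range_psum_eval_const_mult: "F \<in> range psum_eval \<Longrightarrow> mconst a * F \<in> range psum_eval"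
  by (auto simp flip: psum_eval_const_mult)

lemma range_psum_eval_psum_mult:
  "k > 0 \<Longrightarrow> F \<in> range psum_eval \<Longrightarrow> psum k * F \<in> range psum_eval"
  by (auto simp flip: psum_eval_psum_mult)

lemma range_psum_eval_const: "mconst a \<in> range psum_eval"
  by (auto simp flip: psum_eval_const)

lemma range_psum_eval_sum:
  "(\<And>x. x \<in> A \<Longrightarrow> f x \<in> range psum_eval) \<Longrightarrow> (\<Sum>x\<in>A. f x) \<in> range psum_eval"
proof (induction A rule: infinite_finite_induct)
  case (insert x A)
  then have "f x + (\<Sum>x\<in>A. f x) \<in> range psum_eval" by (intro range_psum_eval_add) auto
  then show ?case by (simp only: sum.insert[OF insert.hyps(1,2)])
qed (use range_psum_eval_const[of 0] in simp_all)


section \<open>Power sums generate the symmetric functions freely\<close>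

text \<open>
  Products of power sums are triangular, with nonzero diagonal, in the monomial symmetric
  functions ordered by the number of parts, because merging parts decreases their number.
\<close>

lemma pmon_psum_coeff:
  "\<exists>c. mfps_nth (pmon psum l) m = of_nat c \<and> (c \<noteq> 0 \<longrightarrow> card (keys m) \<le> mdeg l) \<and>
    (card (keys m) = mdeg l \<longrightarrow> (c \<noteq> 0 \<longleftrightarrow> part_type m = l))"
proof (induction l arbitrary: m rule: monom_induct)
  case zero
  have "part_type 0 = 0" by (simp add: part_type_def)
  then show ?case
    by (intro exI[of _ "if m = 0 then 1 else 0"]) (auto simp: mfps_nth_1)
next
  case (add i l)
  let ?J = "{j. Suc i \<le> lookup m j}" and ?r = "\<lambda>j. m - single j (Suc i)"
  obtain c where c: "\<And>m. mfps_nth (pmon psum l) m = of_nat (c m)"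
    "\<And>m. c m \<noteq> 0 \<Longrightarrow> card (keys m) \<le> mdeg l"
    "\<And>m. card (keys m) = mdeg l \<Longrightarrow> c m \<noteq> 0 \<longleftrightarrow> part_type m = l"
    using add by metis
  have fin: "finite ?J"
    by (rule finite_subset[OF _ finite_keys[of m]]) (auto simp: in_keys_iff)
  let ?c = "\<Sum>j\<in>?J. c (?r j)"
  \<comment> \<open>The multiplicities are natural numbers, so no cancellation can occur; this is
    why the coefficient is asserted to be of the form \<open>of_nat c\<close>.\<close>
  have nz: "?c \<noteq> 0 \<longleftrightarrow> (\<exists>j\<in>?J. c (?r j) \<noteq> 0)"
    using fin by simp
  have "pmon psum (single i 1 + l) = psum (Suc i) * pmon psum l"
    by (simp only: pmon_add pmon_single)
  then have "mfps_nth (pmon psum (single i 1 + l)) m = of_nat ?c"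
    using c(1) by (simp add: mfps_nth_adams_X_mult)
  moreover have "card (keys m) \<le> mdeg (single i 1 + l)" if nz': "?c \<noteq> 0"
  proof -
    from nz' nz obtain j where "Suc i \<le> lookup m j" "c (?r j) \<noteq> 0" by blast
    then show ?thesis using card_keys_remove(1)[of "Suc i" m j] c(2)[of "?r j"]
      by (simp add: mdeg_add)
  qed
  moreover have "?c \<noteq> 0 \<longleftrightarrow> part_type m = single i 1 + l"
    if card: "card (keys m) = mdeg (single i 1 + l)"
  proof
    assume "?c \<noteq> 0"
    with nz obtain j where j: "Suc i \<le> lookup m j" "c (?r j) \<noteq> 0" by blast
    \<comment> \<open>Since m has one part more than l has factors, removing x_j^(i+1) must lose a
      part, which forces the exponent of x_j to be exactly \<open>Suc i\<close>.\<close>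
    then have "card (keys (?r j)) = mdeg l"
      using card_keys_remove(1)[of "Suc i" m j] c(2)[of "?r j"] card by (simp add: mdeg_add)
    moreover from this have "lookup m j = Suc i"
      using card_keys_remove(2)[of "Suc i" m j] j card by (simp add: mdeg_add)
    ultimately show "part_type m = single i 1 + l"
      using part_type_remove[of m j i] c(3)[of "?r j"] j by simp
  next
    assume type: "part_type m = single i 1 + l"
    then have "lookup (part_type m) i \<noteq> 0" by (simp add: lookup_add)
    then have "{j. lookup m j = Suc i} \<noteq> {}" by (metis card.empty lookup_part_type)
    then obtain j where j: "lookup m j = Suc i" by blast
    then have "part_type (?r j) = l"
      using part_type_remove[OF j] type by simp
    moreover have "card (keys (?r j)) = mdeg l"
      using calculation by (metis mdeg_part_type)
    ultimately have "c (?r j) \<noteq> 0" using c(3) by blast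
    then show "?c \<noteq> 0" using nz j by auto
  qed
  ultimately show ?case by blast
qed

lemma psum_eval_nth:
  "mfps_nth (psum_eval P) m = (\<Sum>l\<in>keys P. lookup P l * mfps_nth (pmon psum l) m)"
  by (simp add: psum_eval_def psubst_def mfps_nth_sum pmon_def)

text \<open>Leading term argument: take a product l with the largest number of factors and a
  monomial m of type l. Products with fewer factors cannot reach the support size of m, and those
  with equally many have another type, so only l contributes at m.\<close>

lemma psum_eval_eq_0_imp:
  assumes "psum_eval P = 0"
  shows "P = 0"
proof (rule ccontr)
  assume "P \<noteq> 0"
  then have "finite (keys P)" "keys P \<noteq> {}" by simp_all
  then have "Max (mdeg ` keys P) \<in> mdeg ` keys P" by (intro Max_in) auto
  then obtain l where l: "l \<in> keys P" "mdeg l = Max (mdeg ` keys P)" by auto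
  then have max: "mdeg l' \<le> mdeg l" if "l' \<in> keys P" for l'
    using that by (simp add: Max_ge)
  obtain m where m: "part_type m = l" using part_type_surj by blast
  then have card: "card (keys m) = mdeg l" by (metis mdeg_part_type)
  have "mfps_nth (pmon psum l') m = 0" if "l' \<in> keys P - {l}" for l'
    using pmon_psum_coeff[of l' m] max[of l'] m card that by auto
  then have "mfps_nth (psum_eval P) m = lookup P l * mfps_nth (pmon psum l) m"
    using l(1) by (simp add: psum_eval_nth sum.remove)
  moreover have "mfps_nth (pmon psum l) m \<noteq> 0"
    using pmon_psum_coeff[of l m] m card by auto
  ultimately show False using l(1) assms by (simp add: in_keys_iff)
qed

lemma inj_psum_eval: "inj psum_eval"
proof (rule injI)
  fix P Q assume eq: "psum_eval P = psum_eval Q"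
  have "psum_eval (P + single 0 (-1) * Q) = 0"
    using eq by (simp add: psum_eval_add psum_eval_const_mult mconst_minus)
  then have "P + single 0 (-1) * Q = 0" by (rule psum_eval_eq_0_imp)
  moreover have "single 0 (-1) * Q = - Q"
    by (metis mult_minus1 single_one single_uminus)
  ultimately show "P = Q" by simp
qed

text \<open>Injectivity gives the definite description its value, which makes plethysm
  computable.\<close>

lemma psum_expansion_eval: "psum_expansion (psum_eval P) = P"
  unfolding psum_expansion_def psum_eval_def[symmetric]
  by (rule the_equality) (auto dest: injD[OF inj_psum_eval])

subsection \<open>Surjectivity\<close>

lemma symfunD:
  "F \<in> symfun \<Longrightarrow> bij \<pi> \<Longrightarrow> mfps_nth F (Poly_Mapping.map_key \<pi> m) = mfps_nth F m"
  by (simp add: symfun_def)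

lemma symfun_bounded:
  assumes "F \<in> symfun"
  obtains d where "\<And>m. mfps_nth F m \<noteq> 0 \<Longrightarrow> mdeg m \<le> d"
  using assms by (auto simp: symfun_def)

lemma symfun_part_type:
  assumes "F \<in> symfun" "part_type m = part_type n"
  shows "mfps_nth F m = mfps_nth F n"
proof -
  from assms(2) obtain \<pi> where "bij \<pi>" "Poly_Mapping.map_key \<pi> m = n"
    by (rule part_type_eq_imp_permuted)
  then show ?thesis using symfunD[OF assms(1)] by metis
qed

lemma map_key_eq_single_iff:
  assumes "bij \<pi>"
  shows "(\<exists>j. Poly_Mapping.map_key \<pi> m = single j k) \<longleftrightarrow> (\<exists>j. m = single j k)"
proof
  have [simp]: "inj \<pi>" using assms by (simp add: bij_def)
  show "\<exists>j. m = single j k" if *: "\<exists>j. Poly_Mapping.map_key \<pi> m = single j k"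
  proof -
    from * obtain j where j: "Poly_Mapping.map_key \<pi> m = single j k" by blast
    have "lookup m i = lookup (single (\<pi> j) k) i" for i
    proof -
      obtain i' where i: "i = \<pi> i'" using assms by (metis bij_pointE)
      show ?thesis using arg_cong[OF j, of "\<lambda>m. lookup m i'"]
        by (simp add: i map_key.rep_eq lookup_single when_def inj_eq)
    qed
    then have "m = single (\<pi> j) k" by (intro poly_mapping_eqI)
    then show ?thesis by blast
  qed
  show "\<exists>j. Poly_Mapping.map_key \<pi> m = single j k" if *: "\<exists>j. m = single j k"
  proof -
    from * obtain j where "m = single j k" by blast
    moreover obtain i where "j = \<pi> i" using assms by (metis bij_pointE)
    ultimately show ?thesis by auto
  qed
qed

section \<open>Closure properties of the symmetric functions\<close>

lemma symfun_1: "1 \<in> symfun"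
proof -
  have "Poly_Mapping.map_key \<pi> m = 0 \<longleftrightarrow> m = 0" if "bij \<pi>" for \<pi> and m :: "nat \<Rightarrow>\<^sub>0 nat"
    \<comment> \<open>With k = 0 every \<open>single j k\<close> is the zero exponent
      vector.\<close>
    using map_key_eq_single_iff[OF that, of m 0] by simp
  then show ?thesis by (auto simp: symfun_def mfps_nth_1 intro!: exI[of _ 0])
qed

lemma symfun_psum: "k > 0 \<Longrightarrow> psum k \<in> symfun"
  unfolding symfun_def
  by (auto simp: mfps_nth_adams_X map_key_eq_single_iff intro!: exI[of _ k] split: if_splits)

lemma symfun_mult:
  assumes "F \<in> symfun" "G \<in> symfun"
  shows "F * G \<in> symfun"
proof -
  obtain d where d: "\<And>m. mfps_nth F m \<noteq> 0 \<Longrightarrow> mdeg m \<le> d"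
    using symfun_bounded[OF assms(1)] by blast
  obtain e where e: "\<And>m. mfps_nth G m \<noteq> 0 \<Longrightarrow> mdeg m \<le> e"
    using symfun_bounded[OF assms(2)] by blast
  have "mdeg m \<le> d + e" if "mfps_nth (F * G) m \<noteq> 0" for m
  proof -
    from that obtain a b where "a + b = m" "mfps_nth F a * mfps_nth G b \<noteq> 0"
      unfolding times_mfps.rep_eq by (auto elim: sum.not_neutral_contains_not_neutral)
    then show ?thesis using d[of a] e[of b] by (auto simp: mdeg_add)
  qed
  moreover have "mfps_nth (F * G) (Poly_Mapping.map_key \<pi> m) = mfps_nth (F * G) m"
    if "bij \<pi>" for \<pi> m
  proof -
    let ?k = "Poly_Mapping.map_key :: (nat \<Rightarrow> nat) \<Rightarrow> (nat \<Rightarrow>\<^sub>0 nat) \<Rightarrow> _"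
    have inj: "inj \<pi>" "inj (inv \<pi>)" "bij (inv \<pi>)"
      using that by (auto simp: bij_def bij_imp_bij_inv inj_imp_surj_inv surj_imp_inj_inv)
    have inverse: "?k \<pi> (?k (inv \<pi>) a) = a" "?k (inv \<pi>) (?k \<pi> a) = a" for a
      by (rule poly_mapping_eqI, simp add: map_key.rep_eq inj bij_is_surj[OF that] surj_f_inv_f)+
    \<comment> \<open>Permuting the variables is a bijection between the factorizations of a
      monomial and those of its image.\<close>
    show ?thesis
      unfolding times_mfps.rep_eq
      by (rule sum.reindex_bij_witness[where i = "\<lambda>(a, b). (?k \<pi> a, ?k \<pi> b)"
            and j = "\<lambda>(a, b). (?k (inv \<pi>) a, ?k (inv \<pi>) b)"])
        (auto simp: inverse inj symfunD assms that simp flip: map_key_plus)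
  qed
  ultimately show ?thesis unfolding symfun_def by blast
qed

lemma symfun_pmon: "pmon psum l \<in> symfun"
proof (induction l rule: monom_induct)
  case (add i l)
  then show ?case by (simp only: pmon_add pmon_single symfun_mult symfun_psum zero_less_Suc)
qed (simp add: symfun_1)

lemma symfun_mconst_mult: "F \<in> symfun \<Longrightarrow> mconst c * F \<in> symfun"
  unfolding symfun_def by auto

lemma symfun_add:
  assumes "F \<in> symfun" "G \<in> symfun"
  shows "F + G \<in> symfun"
proof -
  obtain d where d: "\<And>m. mfps_nth F m \<noteq> 0 \<Longrightarrow> mdeg m \<le> d"
    using symfun_bounded[OF assms(1)] by blast
  obtain e where e: "\<And>m. mfps_nth G m \<noteq> 0 \<Longrightarrow> mdeg m \<le> e"
    using symfun_bounded[OF assms(2)] by blast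
  have "mdeg m \<le> max d e" if "mfps_nth (F + G) m \<noteq> 0" for m
    using that d[of m] e[of m] by (cases "mfps_nth F m = 0") auto
  then show ?thesis using assms unfolding symfun_def by auto
qed

lemma symfun_sum: "(\<And>x. x \<in> A \<Longrightarrow> f x \<in> symfun) \<Longrightarrow> (\<Sum>x\<in>A. f x) \<in> symfun"
proof (induction A rule: infinite_finite_induct)
  case (insert x A)
  then show ?case by (simp add: symfun_add)
qed (use symfun_mconst_mult[OF symfun_1, of 0] in simp_all)

lemma finite_part_types: "finite {part_type m |m. mdeg m \<le> d}"
proof -
  let ?T = "{part_type m |m. mdeg m \<le> d}"
  let ?S = "{f :: nat \<Rightarrow> nat. \<forall>x. (x \<in> {..d} \<longrightarrow> f x \<in> {..d}) \<and> (x \<notin> {..d} \<longrightarrow> f x = 0)}"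
  have "lookup ` ?T \<subseteq> ?S"
  proof clarify
    fix m i assume m: "mdeg m \<le> d"
    have "lookup (part_type m) i \<le> d"
      using lookup_le_mdeg[of "part_type m" i] card_keys_le_mdeg[of m] m
      by (simp add: mdeg_part_type)
    moreover have "lookup (part_type m) i = 0" if "i > d"
    proof -
      have "lookup m j \<noteq> Suc i" for j
        using lookup_le_mdeg[of m j] that m by linarith
      then show ?thesis by (simp add: lookup_part_type)
    qed
    ultimately show "(i \<in> {..d} \<longrightarrow> lookup (part_type m) i \<in> {..d}) \<and>
        (i \<notin> {..d} \<longrightarrow> lookup (part_type m) i = 0)"
      by auto
  qed
  moreover have "finite ?S" by (rule finite_set_of_finite_funs) auto
  ultimately have "finite (lookup ` ?T)" by (rule finite_subset)
  then show ?thesis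
    by (rule finite_imageD) (auto intro!: inj_onI poly_mapping_eqI)
qed

lemma pmon_in_range: "pmon psum l \<in> range psum_eval"
proof -
  have "pmon psum l = psum_eval (single l 1)"
    by (simp add: psum_eval_def psubst_single[OF scalar_hom_mconst])
  then show ?thesis by blast
qed

text \<open>Elimination on the maximal number N of parts: a combination of N-fold products of power
  sums matches the coefficients of F on supports of size N and has none on larger ones, so the
  difference has strictly smaller supports.\<close>

lemma symfun_in_range_aux:
  assumes "F \<in> symfun" "\<And>m. mfps_nth F m \<noteq> 0 \<Longrightarrow> card (keys m) < N"
  shows "F \<in> range psum_eval"
  using assms
proof (induction N arbitrary: F)
  case 0
  then have "F = 0" by (intro mfps_eqI) auto
  then show ?case by (metis psum_eval_0 rangeI)
next
  case (Suc N)
  obtain d where d: "\<And>m. mfps_nth F m \<noteq> 0 \<Longrightarrow> mdeg m \<le> d"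
    using symfun_bounded[OF Suc.prems(1)] by blast
  define T where "T = {part_type m |m. mfps_nth F m \<noteq> 0 \<and> card (keys m) = N}"
  \<comment> \<open>Bounded degree leaves finitely many types, so the correction \<open>S\<close> is
    a finite sum.\<close>
  have fin: "finite T"
    by (rule finite_subset[OF _ finite_part_types[of d]]) (use d in \<open>auto simp: T_def\<close>)
  have degT: "mdeg l = N" if "l \<in> T" for l
    using that by (auto simp: T_def mdeg_part_type)
  define r where "r l = (SOME m. part_type m = l)" for l
  have r: "part_type (r l) = l" for l
    unfolding r_def by (rule someI_ex[OF part_type_surj])
  \<comment> \<open>The diagonal entry in the denominator is nonzero for \<open>l \<in> T\<close>,
    and symmetry of F and of the product makes the quotient independent of the chosen representative
    \<open>r l\<close>.\<close>
  define a where "a l = mfps_nth F (r l) / mfps_nth (pmon psum l) (r l)" for l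
  define S where "S = (\<Sum>l\<in>T. mconst (a l) * pmon psum l)"
  define G where "G = F + mconst (-1) * S"
  have S: "S \<in> symfun"
    unfolding S_def by (intro symfun_sum symfun_mconst_mult symfun_pmon)
  have "card (keys m) < N" if "mfps_nth G m \<noteq> 0" for m
  proof (rule ccontr)
    assume "\<not> card (keys m) < N"
    then consider "card (keys m) > N" | "card (keys m) = N" by linarith
    then have "mfps_nth F m = mfps_nth S m"
    proof cases
      case 1
      then have "mfps_nth (pmon psum l) m = 0" if "l \<in> T" for l
        using pmon_psum_coeff[of l m] degT[OF that] by auto
      moreover have "mfps_nth F m = 0" using 1 Suc.prems(2)[of m] by auto
      ultimately show ?thesis by (simp add: S_def mfps_nth_sum)
    next
      case 2
      let ?l = "part_type m"
      have zero: "mfps_nth (pmon psum l) m = 0" if "l \<in> T" "l \<noteq> ?l" for l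
        using pmon_psum_coeff[of l m] degT[OF that(1)] 2 that(2) by auto
      show ?thesis
      proof (cases "?l \<in> T")
        case True
        have "mfps_nth S m = a ?l * mfps_nth (pmon psum ?l) m"
          using fin True zero by (simp add: S_def mfps_nth_sum sum.remove)
        moreover have "mfps_nth (pmon psum ?l) m = mfps_nth (pmon psum ?l) (r ?l)"
          "mfps_nth F m = mfps_nth F (r ?l)"
          using symfun_part_type symfun_pmon Suc.prems(1) r by metis+
        moreover have "mfps_nth (pmon psum ?l) m \<noteq> 0"
          using pmon_psum_coeff[of ?l m] by (auto simp: mdeg_part_type)
        ultimately show ?thesis by (simp add: a_def)
      next
        case False
        then have "mfps_nth F m = 0" using 2 by (auto simp: T_def)
        moreover have "mfps_nth S m = 0"
          unfolding S_def mfps_nth_sum using False zero by (intro sum.neutral) auto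
        ultimately show ?thesis by simp
      qed
    qed
    with that show False by (simp add: G_def)
  qed
  moreover have "G \<in> symfun"
    unfolding G_def by (intro symfun_add symfun_mconst_mult Suc.prems S)
  ultimately have "G \<in> range psum_eval" by (rule Suc.IH[rotated])
  moreover have "S \<in> range psum_eval"
    unfolding S_def
    by (intro range_psum_eval_sum range_psum_eval_const_mult pmon_in_range)
  moreover have "F = G + S" by (simp add: G_def mconst_minus)
  ultimately show ?case by (simp add: range_psum_eval_add)
qed

lemma symfun_in_range:
  assumes "F \<in> symfun"
  shows "F \<in> range psum_eval"
proof -
  obtain d where d: "\<And>m. mfps_nth F m \<noteq> 0 \<Longrightarrow> mdeg m \<le> d"
    using symfun_bounded[OF assms] by blast
  then have "card (keys m) < Suc d" if "mfps_nth F m \<noteq> 0" for m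
    using card_keys_le_mdeg[of m] that by (meson le_imp_less_Suc le_trans)
  with assms show ?thesis by (rule symfun_in_range_aux)
qed


section \<open>Newton's identities\<close>

text \<open>
  \<open>hseq s H\<close> says that \<open>H\<close> is $\exp(\sum_{k\ge1} s_k z^k/k)$, the generating function of the
  complete homogeneous symmetric functions of an alphabet with power sums \<open>s\<close>; the differential
  equation avoids the exponential and the denominators.
\<close>

definition hseq :: "(nat \<Rightarrow> 'r::comm_ring_1) \<Rightarrow> 'r fps \<Rightarrow> bool"
  where "hseq s H \<longleftrightarrow> fps_nth H 0 = 1 \<and> fps_deriv H = Abs_fps (\<lambda>n. s (Suc n)) * H"

lemma hseq_iff:
  "hseq s H \<longleftrightarrow> fps_nth H 0 = 1 \<and>
    (\<forall>n. of_nat (Suc n) * fps_nth H (Suc n) = (\<Sum>i=0..n. s (Suc i) * fps_nth H (n - i)))"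
  by (simp add: hseq_def fps_eq_iff fps_mult_nth del: of_nat_Suc)

lemma hseq_cong: "hseq s H \<Longrightarrow> (\<And>k. k > 0 \<Longrightarrow> s k = s' k) \<Longrightarrow> hseq s' H"
  by (simp add: hseq_def)

text \<open>Newton's identities determine (n+1) H_(n+1) from earlier coefficients; cancelling n+1
  requires torsion-freeness, which is supplied separately for each coefficient ring.\<close>

lemma hseq_unique:
  fixes H H' :: "'r::comm_ring_1 fps"
  assumes torsion_free: "\<And>n x. of_nat (Suc n) * x = (0 :: 'r) \<Longrightarrow> x = 0"
    and "hseq s H" "hseq s H'"
  shows "H = H'"
proof (rule fps_ext)
  fix n show "fps_nth H n = fps_nth H' n"
  proof (induction n rule: less_induct)
    case (less n)
    show ?case
    proof (cases n)
      case (Suc m)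
      have "of_nat (Suc m) * fps_nth H (Suc m) = of_nat (Suc m) * fps_nth H' (Suc m)"
        using assms(2,3) less.IH unfolding hseq_iff Suc by (auto intro!: sum.cong)
      then have "of_nat (Suc m) * (fps_nth H (Suc m) - fps_nth H' (Suc m)) = 0"
        by (simp add: algebra_simps)
      from torsion_free[OF this] show ?thesis by (simp add: Suc)
    qed (use assms in \<open>simp add: hseq_def\<close>)
  qed
qed

text \<open>The product rule; this is Omega[A + B] = Omega[A] Omega[B].\<close>

lemma hseq_mult:
  assumes "hseq s H" "hseq s' H'"
  shows "hseq (\<lambda>k. s k + s' k) (H * H')"
proof -
  have "Abs_fps (\<lambda>n. s (Suc n) + s' (Suc n)) = Abs_fps (\<lambda>n. s (Suc n)) + Abs_fps (\<lambda>n. s' (Suc n))"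
    by (rule fps_ext) simp
  then show ?thesis using assms by (simp add: hseq_def algebra_simps)
qed

lemma hseq_1: "hseq (\<lambda>_. 0) 1"
  by (simp add: hseq_def fps_eq_iff)

text \<open>Corresponds to substituting cz for z in the exponential.\<close>

lemma hseq_scale:
  assumes "hseq s H"
  shows "hseq (\<lambda>k. c ^ k * s k) (Abs_fps (\<lambda>n. c ^ n * fps_nth H n))"
proof -
  have "of_nat (Suc n) * (c ^ Suc n * fps_nth H (Suc n))
      = (\<Sum>i=0..n. c ^ Suc i * s (Suc i) * (c ^ (n - i) * fps_nth H (n - i)))" for n
  proof -
    have "of_nat (Suc n) * (c ^ Suc n * fps_nth H (Suc n))
        = c ^ Suc n * (\<Sum>i=0..n. s (Suc i) * fps_nth H (n - i))"
      using assms unfolding hseq_iff by (metis mult.left_commute)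
    also have "\<dots> = (\<Sum>i=0..n. c ^ Suc i * s (Suc i) * (c ^ (n - i) * fps_nth H (n - i)))"
      unfolding sum_distrib_left
    proof (rule sum.cong)
      fix i assume "i \<in> {0..n}"
      then have "c ^ Suc n = c ^ Suc i * c ^ (n - i)" by (simp add: mult.assoc flip: power_add)
      then show "c ^ Suc n * (s (Suc i) * fps_nth H (n - i))
          = c ^ Suc i * s (Suc i) * (c ^ (n - i) * fps_nth H (n - i))"
        by (simp only: mult_ac)
    qed simp
    finally show ?thesis .
  qed
  then show ?thesis using assms by (simp add: hseq_iff del: of_nat_Suc power_Suc)
qed

text \<open>Newton's identities involve only sums, products and integers, so ring homomorphisms
  preserve them.\<close>

lemma hseq_map:
  fixes f :: "'r::comm_ring_1 \<Rightarrow> 's::comm_ring_1"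
  assumes f: "f 0 = 0" "f 1 = 1" "\<And>x y. f (x + y) = f x + f y" "\<And>x y. f (x * y) = f x * f y"
    and "hseq s H"
  shows "hseq (\<lambda>k. f (s k)) (Abs_fps (\<lambda>n. f (fps_nth H n)))"
proof -
  have nat: "f (of_nat n) = of_nat n" for n by (induction n) (simp_all add: f)
  have sum: "f (\<Sum>x\<in>A. g x) = (\<Sum>x\<in>A. f (g x))" for g and A :: "nat set"
    by (induction A rule: infinite_finite_induct) (simp_all add: f)
  have "of_nat (Suc n) * f (fps_nth H (Suc n)) = (\<Sum>i=0..n. f (s (Suc i)) * f (fps_nth H (n - i)))" for n
  proof -
    have "of_nat (Suc n) * f (fps_nth H (Suc n)) = f (of_nat (Suc n) * fps_nth H (Suc n))"
      by (simp only: f nat)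
    also have "\<dots> = f (\<Sum>i=0..n. s (Suc i) * fps_nth H (n - i))"
      using assms(5) by (simp only: hseq_iff)
    finally show ?thesis by (simp add: sum f)
  qed
  then show ?thesis using assms(5) by (simp add: hseq_iff f del: of_nat_Suc)
qed

section \<open>Exponentials of explicit scalar alphabets\<close>

lemma hseq_geometric: "hseq (\<lambda>k. x ^ k) (Abs_fps (\<lambda>n. x ^ n))"
proof -
  have "(\<Sum>i=0..n. x ^ Suc i * x ^ (n - i)) = (\<Sum>i=0..n. x ^ Suc n)" for n
    by (intro sum.cong) (simp_all add: mult.assoc flip: power_add)
  then show ?thesis unfolding hseq_iff by simp
qed

lemma hseq_linear: "hseq (\<lambda>k. - (x ^ k)) (1 - fps_const x * fps_X)"
  unfolding hseq_iff
proof safe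
  fix n
  let ?H = "1 - fps_const x * fps_X"
  have H: "fps_nth ?H m = (if m = 0 then 1 else if m = 1 then - x else 0)" for m
    by (simp add: fps_X_def)
  show "of_nat (Suc n) * fps_nth ?H (Suc n) = (\<Sum>i=0..n. - (x ^ Suc i) * fps_nth ?H (n - i))"
  proof (cases n)
    case (Suc m)
    \<comment> \<open>A linear polynomial leaves only the last two terms of the convolution, and
      they cancel.\<close>
    have "(\<Sum>i=0..n. - (x ^ Suc i) * fps_nth ?H (n - i))
        = (\<Sum>i\<in>{m, Suc m}. - (x ^ Suc i) * fps_nth ?H (n - i))"
      by (rule sum.mono_neutral_right) (auto simp: H Suc)
    also have "\<dots> = 0" by (simp add: H Suc)
    finally show ?thesis by (simp add: H Suc)
  qed (simp add: H)
qed simp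

text \<open>The expansion of $\Omega[z(1-x)(1-y)] = \frac{(1-xz)(1-yz)}{(1-z)(1-xyz)}$.\<close>

lemma hseq_rational:
  fixes x y :: "'a::field"
  assumes "x * y \<noteq> 1"
  shows "hseq (\<lambda>k. (1 - x ^ k) * (1 - y ^ k))
    (Abs_fps (\<lambda>n. if n = 0 then 1 else (1 - x) * (1 - y) / (x * y - 1) * ((x * y) ^ n - 1)))"
proof -
  let ?Q = "x * y"
  let ?G = "Abs_fps (\<lambda>n. if n = 0 then 1 else (1 - x) * (1 - y) / (?Q - 1) * (?Q ^ n - 1))"
  \<comment> \<open>The denominator part 1/((1-z)(1-xyz)); the two linear factors of the numerator
    are multiplied in afterwards.\<close>
  define A where "A = Abs_fps (\<lambda>n. 1 ^ n) * Abs_fps (\<lambda>n. ?Q ^ n)"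
  have A: "fps_nth A n = (?Q ^ Suc n - 1) / (?Q - 1)" for n
  proof -
    have "fps_nth A n = (\<Sum>i=0..n. ?Q ^ (n - i))" by (simp add: A_def fps_mult_nth)
    also have "\<dots> = (\<Sum>i<Suc n. ?Q ^ i)"
      by (rule sum.reindex_bij_witness[where i = "\<lambda>i. n - i" and j = "\<lambda>i. n - i"]) auto
    also have "\<dots> = (?Q ^ Suc n - 1) / (?Q - 1)"
      by (rule geometric_sum[OF assms])
    finally show ?thesis .
  qed
  have "hseq (\<lambda>k. 1 ^ k + ?Q ^ k + - (x ^ k) + - (y ^ k))
      (A * (1 - fps_const x * fps_X) * (1 - fps_const y * fps_X))"
    unfolding A_def by (intro hseq_mult hseq_geometric hseq_linear)
  moreover have "A * (1 - fps_const x * fps_X) * (1 - fps_const y * fps_X) = ?G"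
  proof (rule fps_ext)
    fix n
    have "A * (1 - fps_const x * fps_X) * (1 - fps_const y * fps_X)
        = A - fps_const (x + y) * (fps_X * A) + fps_const ?Q * (fps_X * (fps_X * A))"
      by (simp add: algebra_simps flip: fps_const_add fps_const_mult)
    then have "fps_nth (A * (1 - fps_const x * fps_X) * (1 - fps_const y * fps_X)) n
        = fps_nth A n - (x + y) * (if n = 0 then 0 else fps_nth A (n - 1))
          + ?Q * (if n = 0 then 0 else if n = 1 then 0 else fps_nth A (n - 2))"
      by (simp add: fps_X_mult_nth numeral_2_eq_2)
    also have "\<dots> = fps_nth ?G n"
    proof (cases n)
      case 0
      then show ?thesis using assms by (simp add: A)
    next
      case (Suc m)
      \<comment> \<open>The formula for the coefficients of \<open>A\<close> vanishes at index -1,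
        so the case n = 1 needs no separate treatment.\<close>
      have "(if n = 0 then 0 else if n = 1 then 0 else fps_nth A (n - 2)) = (?Q ^ m - 1) / (?Q - 1)"
        by (cases m) (simp_all add: Suc A)
      then have "fps_nth A n - (x + y) * (if n = 0 then 0 else fps_nth A (n - 1))
          + ?Q * (if n = 0 then 0 else if n = 1 then 0 else fps_nth A (n - 2))
        = ((?Q ^ Suc (Suc m) - 1) - (x + y) * (?Q ^ Suc m - 1) + ?Q * (?Q ^ m - 1)) / (?Q - 1)"
      proof -
        have "u / d - r * (v / d) + p * (w / d) = (u - r * v + p * w) / d" for u v w d r p :: 'a
          by (simp add: add_divide_distrib diff_divide_distrib)
        then show ?thesis
          using \<open>(if n = 0 then 0 else _) = _\<close> by (simp only: Suc A nat.simps if_False diff_Suc_1)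
      qed
      \<comment> \<open>Both the coefficient of \<open>?Q ^ Suc m\<close> and minus the constant
        term equal 1 - x - y + xy, that is (1-x)(1-y).\<close>
      also have "(?Q ^ Suc (Suc m) - 1) - (x + y) * (?Q ^ Suc m - 1) + ?Q * (?Q ^ m - 1)
          = (1 - x) * (1 - y) * (?Q ^ Suc m - 1)"
        by (simp add: algebra_simps)
      finally show ?thesis by (simp add: Suc)
    qed
    finally show "fps_nth (A * (1 - fps_const x * fps_X) * (1 - fps_const y * fps_X)) n
        = fps_nth ?G n" .
  qed
  ultimately have "hseq (\<lambda>k. 1 ^ k + ?Q ^ k + - (x ^ k) + - (y ^ k)) ?G" by metis
  then show ?thesis
    by (rule hseq_cong) (simp add: algebra_simps power_mult_distrib)
qed

section \<open>Torsion-freeness, and Newton's identities for h_n\<close>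

lemma mfps_torsion_free:
  fixes x :: "qt mfps"
  assumes "of_nat (Suc n) * x = 0"
  shows "x = 0"
proof (rule mfps_eqI)
  fix m
  have "of_nat (Suc n) * mfps_nth x m = 0"
    using arg_cong[OF assms, of "\<lambda>f. mfps_nth f m"] by (simp del: of_nat_Suc)
  then show "mfps_nth x m = mfps_nth 0 m" by (simp del: of_nat_Suc)
qed

lemma fls_nth_of_nat_mult: "fls_nth (of_nat n * f) i = of_nat n * (fls_nth f i :: 'a :: comm_ring_1)"
  by (induction n) (auto simp: algebra_simps)

lemma mfps_fls_torsion_free:
  fixes x :: "qt mfps fls"
  assumes "of_nat (Suc n) * x = 0"
  shows "x = 0"
proof (rule fls_eqI)
  fix i
  have "of_nat (Suc n) * fls_nth x i = 0"
    using arg_cong[OF assms, of "\<lambda>f. fls_nth f i"] by (simp only: fls_nth_of_nat_mult fls_zero_nth)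
  then show "fls_nth x i = fls_nth 0 i" by (simp only: fls_zero_nth mfps_torsion_free)
qed

text \<open>Double counting: for a monomial m of degree n+1, the pairs (i, j) with x_j^(i+1)
  dividing m number the sum of the exponents, hence n+1.\<close>

lemma hseq_h_sym: "hseq psum (Abs_fps h_sym)"
  unfolding hseq_iff
proof (intro conjI allI)
  show "fps_nth (Abs_fps h_sym) 0 = 1"
    by (rule mfps_eqI) (simp add: h_sym_def mfps_nth_1 mdeg_eq_0_iff)
next
  fix n
  have "mfps_nth (of_nat (Suc n) * h_sym (Suc n)) m
      = mfps_nth (\<Sum>i=0..n. psum (Suc i) * h_sym (n - i)) m" for m
  proof -
    have rm: "mdeg (m - single j (Suc i)) = n - i \<longleftrightarrow> mdeg m = Suc n"
      if "Suc i \<le> lookup m j" "i \<le> n" for i j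
    proof -
      have "mdeg m = Suc i + mdeg (m - single j (Suc i))"
        using monom_split[OF that(1)] mdeg_add mdeg_single by metis
      then show ?thesis using that(2) by linarith
    qed
    have J: "{j. Suc i \<le> lookup m j} = {j\<in>keys m. Suc i \<le> lookup m j}" for i
      by (auto simp: in_keys_iff)
    have "mfps_nth (\<Sum>i=0..n. psum (Suc i) * h_sym (n - i)) m
        = (\<Sum>i=0..n. \<Sum>j | Suc i \<le> lookup m j. if mdeg m = Suc n then 1 else 0)"
      unfolding mfps_nth_sum
      by (intro sum.cong refl, subst mfps_nth_adams_X_mult)
        (auto intro!: sum.cong simp: h_sym_def rm)
    also have "\<dots> = (if mdeg m = Suc n then of_nat (Suc n) else 0)"
    proof (cases "mdeg m = Suc n")
      case True
      have "(\<Sum>i=0..n. \<Sum>j | Suc i \<le> lookup m j. 1)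
          = (\<Sum>j\<in>keys m. \<Sum>i=0..n. if Suc i \<le> lookup m j then 1 else 0 :: qt)"
        unfolding J by (subst sum.swap) (simp add: sum.If_cases Int_def conj_commute)
      also have "\<dots> = (\<Sum>j\<in>keys m. of_nat (lookup m j))"
      proof (rule sum.cong)
        fix j assume "j \<in> keys m"
        have "{i. i \<le> n \<and> Suc i \<le> lookup m j} = {..<lookup m j}"
          using lookup_le_mdeg[of m j] True by auto
        then show "(\<Sum>i=0..n. if Suc i \<le> lookup m j then 1 else 0 :: qt) = of_nat (lookup m j)"
          by (simp add: sum.If_cases Int_def)
      qed simp
      also have "\<dots> = of_nat (mdeg m)" by (simp add: mdeg_def)
      finally show ?thesis using True by simp
    qed simp
    finally show ?thesis by (simp add: h_sym_def del: of_nat_Suc)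
  qed
  then show "of_nat (Suc n) * fps_nth (Abs_fps h_sym) (Suc n)
      = (\<Sum>i=0..n. psum (Suc i) * fps_nth (Abs_fps h_sym) (n - i))"
    by (simp only: fps_nth_Abs_fps) (rule mfps_eqI)
qed


section \<open>The exponential \<open>Omega\<close>\<close>

text \<open>Agreement below order N puts the N-th partial sum within 2^(-N) of the limit in the
  z-adic metric.\<close>

lemma fls_sumsI:
  fixes f :: "nat \<Rightarrow> 'a::comm_ring_1 fls"
  assumes "\<And>N n. n < int N \<Longrightarrow> fls_nth (\<Sum>k<N. f k) n = fls_nth g n"
  shows "f sums g"
proof -
  let ?S = "\<lambda>N. \<Sum>k<N. f k"
  have le: "dist (?S N) g \<le> (1 / 2) ^ N" for N
  proof (cases "?S N = g")
    case False
    then have nz: "?S N - g \<noteq> 0" by simp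
    have sub: "int N \<le> fls_subdegree (?S N - g)"
      by (rule fls_subdegree_geI[OF nz]) (simp add: assms)
    then have "N \<le> nat (fls_subdegree (?S N - g))" by linarith
    then have "(2::real) ^ N \<le> 2 ^ nat (fls_subdegree (?S N - g))"
      by (intro power_increasing) auto
    then show ?thesis
      using False sub by (simp add: dist_fls_def field_simps power_divide)
  qed simp
  have "(\<lambda>N. (1 / 2 :: real) ^ N) \<longlonglongrightarrow> 0" by (rule LIMSEQ_realpow_zero) auto
  then have "(\<lambda>N. dist (?S N) g) \<longlonglongrightarrow> 0"
    by (rule tendsto_sandwich[OF _ _ tendsto_const, rotated 2]) (auto simp: le)
  then show ?thesis unfolding sums_def by (subst tendsto_dist_iff)
qed

context
  fixes E :: "qt mfps"
begin

definition omega_log :: "qt mfps fps"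
  where "omega_log = Abs_fps (\<lambda>n. if n = 0 then 0 else mconst (1 / of_nat n) * adams n E)"

definition omega_partial :: "nat \<Rightarrow> qt mfps fps"
  where "omega_partial N = (\<Sum>n<N. fps_const (mconst (1 / of_nat (fact n))) * omega_log ^ n)"

text \<open>The exponential of \<open>omega_log\<close> without a limit: \<open>omega_log\<close>
  has no constant term, so coefficient n is already stable in the partial sum with the powers 0 to
  n.\<close>

definition omega_fps :: "qt mfps fps"
  where "omega_fps = Abs_fps (\<lambda>n. fps_nth (omega_partial (Suc n)) n)"

lemma omega_partial_nth:
  assumes "n < N"
  shows "fps_nth (omega_partial N) n = fps_nth omega_fps n"
proof -
  have "fps_nth (omega_log ^ k) n = 0" if "k > n" for k
    using that startsby_zero_power_prefix[of omega_log k] by (simp add: omega_log_def)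
  then have "fps_nth (omega_partial (Suc n + k)) n = fps_nth (omega_partial (Suc n)) n" for k
    by (induction k) (simp_all add: omega_partial_def del: power_Suc of_nat_Suc of_nat_fact fact_Suc)
  from this[of "N - Suc n"] assms show ?thesis by (simp add: omega_fps_def)
qed

text \<open>Differentiating a truncated exponential lowers each power by one, so the truncation
  order drops by one too.\<close>

lemma omega_partial_deriv:
  "fps_deriv (omega_partial (Suc N)) = fps_deriv omega_log * omega_partial N"
proof (induction N)
  case (Suc N)
  have "of_nat (Suc N) * mconst (1 / of_nat (fact (Suc N))) = (mconst (1 / of_nat (fact N)) :: qt mfps)"
  proof -
    have "of_nat (fact (Suc N)) = (of_nat (Suc N) * of_nat (fact N) :: qt)"
      by (simp only: fact_Suc of_nat_mult of_nat_id)
    then show ?thesis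
      by (intro mfps_eqI) (simp add: mfps_nth_mconst del: of_nat_Suc of_nat_fact fact_Suc)
  qed
  then have c: "fps_const (mconst (1 / of_nat (fact (Suc N)))) * fps_const (of_nat (Suc N))
      = fps_const (mconst (1 / of_nat (fact N)) :: qt mfps)"
    by (simp only: fps_const_mult mult.commute[of "mconst _"])
  have "fps_deriv (omega_partial (Suc (Suc N))) = fps_deriv (omega_partial (Suc N))
      + fps_const (mconst (1 / of_nat (fact (Suc N)))) * fps_deriv (omega_log ^ Suc N)"
    by (simp add: omega_partial_def del: fact_Suc of_nat_fact power_Suc)
  also have "fps_const (mconst (1 / of_nat (fact (Suc N)))) * fps_deriv (omega_log ^ Suc N)
      = fps_const (mconst (1 / of_nat (fact (Suc N)))) * fps_const (of_nat (Suc N))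
        * (fps_deriv omega_log * omega_log ^ N)"
    by (simp only: fps_deriv_power diff_Suc_1 mult_ac)
  finally show ?case
    unfolding Suc.IH c by (simp add: omega_partial_def algebra_simps)
qed (simp add: omega_partial_def)

lemma hseq_omega_fps: "hseq (\<lambda>k. adams k E) omega_fps"
proof -
  have log: "fps_deriv omega_log = Abs_fps (\<lambda>n. adams (Suc n) E)"
    by (intro fps_ext mfps_eqI) (simp add: omega_log_def del: of_nat_Suc)
  have "fps_nth (fps_deriv omega_fps) n = fps_nth (fps_deriv omega_log * omega_fps) n" for n
  proof -
    \<comment> \<open>Coefficient n of the derivative reads coefficient n+1, which is stable from
      the partial sum of length n+2 on.\<close>
    have "fps_nth (fps_deriv omega_fps) n = fps_nth (fps_deriv (omega_partial (Suc (Suc n)))) n"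
      by (simp add: omega_partial_nth del: of_nat_Suc)
    also have "\<dots> = fps_nth (fps_deriv omega_log * omega_fps) n"
      unfolding omega_partial_deriv fps_mult_nth
      by (intro sum.cong) (simp_all add: omega_partial_nth)
    finally show ?thesis .
  qed
  moreover have "fps_nth omega_fps 0 = 1"
    by (simp add: omega_fps_def omega_partial_def)
  ultimately show ?thesis unfolding hseq_def log by (simp add: fps_ext)
qed

lemma adamsz_X_const:
  assumes "k > 0"
  shows "adamsz k (fls_X * fls_const E) = fps_to_fls (fps_const (adams k E) * fps_X ^ k)"
proof (rule fls_eqI)
  fix n
  have "fls_nth (fls_X * fls_const E) m = (if m = 1 then E else 0)" for m
    by (simp add: fls_X_times_conv_shift fls_const_nth)
  then have "fls_nth (adamsz k (fls_X * fls_const E)) n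
      = (if int k dvd n \<and> n div int k = 1 then adams k E else 0)"
    using assms by (simp add: fls_nth_adamsz)
  also have "int k dvd n \<and> n div int k = 1 \<longleftrightarrow> n = int k"
    using assms by auto
  finally show "fls_nth (adamsz k (fls_X * fls_const E)) n
      = fls_nth (fps_to_fls (fps_const (adams k E) * fps_X ^ k)) n"
    using assms by (auto simp: fps_X_power_nth)
qed

text \<open>Evaluates both infinite sums in \<open>Omega\<close>; afterwards only Newton's
  identities for \<open>omega_fps\<close> are used.\<close>

lemma Omega_X_const: "Omega (fls_X * fls_const E) = fps_to_fls omega_fps"
proof -
  have const: "fls_const c = fps_to_fls (fps_const c)" for c :: "qt mfps" by simp
  have sum: "(\<Sum>k\<in>A. fps_to_fls (f k)) = fps_to_fls (\<Sum>k\<in>A. f k)"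
    for A :: "nat set" and f :: "nat \<Rightarrow> qt mfps fps"
    by (induction A rule: infinite_finite_induct) (simp_all add: fps_to_fls_plus)
  have "(\<lambda>k. scalz (1 / of_nat (Suc k)) * adamsz (Suc k) (fls_X * fls_const E)) sums
      fps_to_fls omega_log"
  proof (rule fls_sumsI)
    fix N and n :: int assume n: "n < int N"
    have "(\<Sum>k<N. scalz (1 / of_nat (Suc k)) * adamsz (Suc k) (fls_X * fls_const E))
        = fps_to_fls (\<Sum>k<N. fps_const (mconst (1 / of_nat (Suc k)))
            * (fps_const (adams (Suc k) E) * fps_X ^ Suc k))"
      unfolding adamsz_X_const[OF zero_less_Suc] sum[symmetric]
      by (simp only: const fls_times_fps_to_fls)
    moreover have "fps_nth (\<Sum>k<N. fps_const (mconst (1 / of_nat (Suc k)))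
            * (fps_const (adams (Suc k) E) * fps_X ^ Suc k)) m = fps_nth omega_log m"
      if "m < N" for m
    proof -
      have "fps_nth (\<Sum>k<N. fps_const (mconst (1 / of_nat (Suc k)))
            * (fps_const (adams (Suc k) E) * fps_X ^ Suc k)) m
          = (\<Sum>k<N. if Suc k = m then mconst (1 / of_nat m) * adams m E else 0)"
        unfolding fps_sum_nth by (intro sum.cong) (auto simp: fps_X_power_nth)
      also have "\<dots> = fps_nth omega_log m"
        using that by (cases m) (auto simp: omega_log_def)
      finally show ?thesis .
    qed
    ultimately show "fls_nth (\<Sum>k<N. scalz (1 / of_nat (Suc k))
          * adamsz (Suc k) (fls_X * fls_const E)) n = fls_nth (fps_to_fls omega_log) n"
      using n by (auto simp: nat_less_iff)
  qed
  then have log: "suminf (\<lambda>k. scalz (1 / of_nat (Suc k)) * adamsz (Suc k) (fls_X * fls_const E))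
      = fps_to_fls omega_log"
    by (rule sums_unique[symmetric])
  have pow: "fps_to_fls f ^ n = fps_to_fls (f ^ n)" for f :: "qt mfps fps" and n
    by (induction n) (simp_all add: fls_times_fps_to_fls)
  have "(\<lambda>n. scalz (1 / of_nat (fact n)) * fps_to_fls omega_log ^ n) sums fps_to_fls omega_fps"
  proof (rule fls_sumsI)
    fix N and n :: int assume n: "n < int N"
    have "(\<Sum>n<N. scalz (1 / of_nat (fact n)) * fps_to_fls omega_log ^ n)
        = fps_to_fls (omega_partial N)"
      unfolding omega_partial_def sum[symmetric]
      by (simp only: const pow fls_times_fps_to_fls)
    then show "fls_nth (\<Sum>n<N. scalz (1 / of_nat (fact n)) * fps_to_fls omega_log ^ n) n
        = fls_nth (fps_to_fls omega_fps) n"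
      using n by (auto simp: nat_less_iff omega_partial_nth)
  qed
  then show ?thesis unfolding Omega_def log by (rule sums_unique[symmetric])
qed

end


section \<open>Evaluation of symmetric functions\<close>

text \<open>Common form of \<open>pleth\<close> and \<open>plethz\<close>, with free values for the
  power sums.\<close>

definition sym_eval :: "(qt \<Rightarrow> 'r::comm_ring_1) \<Rightarrow> (nat \<Rightarrow> 'r) \<Rightarrow> qt mfps \<Rightarrow> 'r"
  where "sym_eval c p F = psubst c p (psum_expansion F)"

text \<open>Newton's recursion, with division by n in the ground field, expresses each coefficient
  by power sums. It shows in particular that h_n[X] and h_n[-X] can be evaluated.\<close>

lemma hseq_in_range:
  assumes "hseq (\<lambda>k. mconst (e k) * psum k) K"
  shows "fps_nth K n \<in> range psum_eval"
proof (induction n rule: less_induct)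
  case (less n)
  show ?case
  proof (cases n)
    case 0
    then show ?thesis using assms range_psum_eval_const[of 1] by (simp add: hseq_def)
  next
    case (Suc m)
    have "mconst (1 / of_nat (Suc m)) * (of_nat (Suc m) * fps_nth K (Suc m)) = fps_nth K (Suc m)"
      by (rule mfps_eqI) (simp del: of_nat_Suc)
    moreover have "of_nat (Suc m) * fps_nth K (Suc m)
        = (\<Sum>i=0..m. mconst (e (Suc i)) * (psum (Suc i) * fps_nth K (m - i)))"
      using assms by (simp only: hseq_iff mult.assoc)
    moreover have "\<dots> \<in> range psum_eval"
      using less.IH Suc
      by (intro range_psum_eval_sum range_psum_eval_const_mult range_psum_eval_psum_mult) auto
    ultimately show ?thesis using range_psum_eval_const_mult Suc by metis
  qed
qed

context
  fixes c :: "qt \<Rightarrow> 'r::comm_ring_1" and p :: "nat \<Rightarrow> 'r"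
  assumes c: "scalar_hom c"
begin

lemma sym_eval_psum_eval: "sym_eval c p (psum_eval P) = psubst c p P"
  by (simp add: sym_eval_def psum_expansion_eval)

lemma sym_eval_add:
  assumes "F \<in> range psum_eval" "G \<in> range psum_eval"
  shows "sym_eval c p (F + G) = sym_eval c p F + sym_eval c p G"
  using assms by (auto simp: sym_eval_psum_eval psubst_add[OF c] simp flip: psum_eval_add)

lemma sym_eval_const_mult:
  assumes "F \<in> range psum_eval"
  shows "sym_eval c p (mconst a * F) = c a * sym_eval c p F"
  using assms
  by (auto simp: sym_eval_psum_eval psubst_single_mult[OF c] simp flip: psum_eval_const_mult)

lemma sym_eval_psum_mult:
  assumes "k > 0" "F \<in> range psum_eval"
  shows "sym_eval c p (psum k * F) = p k * sym_eval c p F"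
proof -
  obtain P where P: "F = psum_eval P" using assms(2) by blast
  have "c 1 = 1" using c by (simp add: scalar_hom_def)
  then show ?thesis
    using assms(1) pmon_single[of p "k - 1"] psum_eval_psum_mult[OF assms(1), of P, symmetric]
    by (simp add: P sym_eval_psum_eval psubst_single_mult[OF c])
qed

lemma sym_eval_const: "sym_eval c p (mconst a) = c a"
  by (simp add: sym_eval_psum_eval psubst_single[OF c] flip: psum_eval_const)

lemma sym_eval_1: "sym_eval c p 1 = 1"
  using sym_eval_const[of 1] c by (simp add: scalar_hom_def)

lemma sym_eval_0: "sym_eval c p 0 = 0"
  using sym_eval_const[of 0] c by (simp add: scalar_hom_def)

lemma sym_eval_sum:
  assumes "\<And>x. x \<in> A \<Longrightarrow> f x \<in> range psum_eval"
  shows "sym_eval c p (\<Sum>x\<in>A. f x) = (\<Sum>x\<in>A. sym_eval c p (f x))"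
  using assms
proof (induction A rule: infinite_finite_induct)
  case (insert x A)
  have "sym_eval c p (f x + (\<Sum>x\<in>A. f x)) = sym_eval c p (f x) + (\<Sum>x\<in>A. sym_eval c p (f x))"
    using insert by (subst sym_eval_add) (auto intro: range_psum_eval_sum)
  then show ?case using insert.hyps by simp
qed (simp_all add: sym_eval_0)

text \<open>Each product in Newton's identities has a scalar times a power sum as one factor, so
  additivity and compatibility with these suffice to transport them.\<close>

lemma hseq_sym_eval:
  assumes K: "hseq (\<lambda>k. mconst (e k) * psum k) K"
  shows "hseq (\<lambda>k. c (e k) * p k) (Abs_fps (\<lambda>n. sym_eval c p (fps_nth K n)))"
  unfolding hseq_iff
proof (intro conjI allI)
  show "fps_nth (Abs_fps (\<lambda>n. sym_eval c p (fps_nth K n))) 0 = 1"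
    using K by (simp add: hseq_def sym_eval_1)
next
  fix n
  note range = hseq_in_range[OF K]
  have nat: "c (of_nat k) = of_nat k" for k
    using c by (induction k) (auto simp: scalar_hom_def)
  have "of_nat (Suc n) * sym_eval c p (fps_nth K (Suc n))
      = sym_eval c p (mconst (of_nat (Suc n)) * fps_nth K (Suc n))"
    by (simp only: sym_eval_const_mult[OF range] nat)
  also have "mconst (of_nat (Suc n)) * fps_nth K (Suc n) = of_nat (Suc n) * fps_nth K (Suc n)"
    by (rule mfps_eqI) (simp del: of_nat_Suc)
  also have "\<dots> = (\<Sum>i=0..n. mconst (e (Suc i)) * (psum (Suc i) * fps_nth K (n - i)))"
    using K by (simp only: hseq_iff mult.assoc)
  also have "sym_eval c p \<dots> = (\<Sum>i=0..n. c (e (Suc i)) * p (Suc i) * sym_eval c p (fps_nth K (n - i)))"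
    using range
    by (subst sym_eval_sum) (auto simp: sym_eval_const_mult sym_eval_psum_mult
        range_psum_eval_psum_mult mult.assoc intro!: range_psum_eval_const_mult range_psum_eval_psum_mult)
  finally show "of_nat (Suc n) * fps_nth (Abs_fps (\<lambda>n. sym_eval c p (fps_nth K n))) (Suc n)
      = (\<Sum>i=0..n. c (e (Suc i)) * p (Suc i) * fps_nth (Abs_fps (\<lambda>n. sym_eval c p (fps_nth K n))) (n - i))"
    by simp
qed

end


section \<open>Vertex operators\<close>

text \<open>\<open>D_op\<close> has \<mu> = M and H = Omega[-zX], while \<open>D_star\<close> has
  \<mu> = -M~ and H = Omega[zX]; the common form lets both be handled together.\<close>

definition vop :: "qt \<Rightarrow> qt mfps fps \<Rightarrow> int \<Rightarrow> qt mfps \<Rightarrow> qt mfps"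
  where "vop \<mu> H a F =
    fls_nth (plethz F (fls_const X_alph + scalz \<mu> * fls_X_inv) * fps_to_fls H) a"

lemma D_op_eq: "D_op a F = vop M_qt (omega_fps (- X_alph)) a F"
proof -
  have "- (fls_X * fls_const X_alph) = fls_X * fls_const (- X_alph)"
    by simp
  then show ?thesis by (simp only: D_op_def vop_def Omega_X_const)
qed

lemma D_star_eq: "D_star a F = vop (- M_tilde) (omega_fps X_alph) a F"
  by (simp add: D_star_def vop_def Omega_X_const mconst_minus)

context
  fixes \<mu> :: qt and H :: "qt mfps fps"
begin

definition vop_psum :: "nat \<Rightarrow> qt mfps fls"
  where "vop_psum k = adamsz k (fls_const X_alph + scalz \<mu> * fls_X_inv)"

lemma fls_X_inv_power_nth: "fls_nth (fls_X_inv ^ k) n = (if n = - int k then 1 else 0 :: 'a::comm_ring_1)"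
  by (simp add: fls_X_inv_power_conv_shift_1)

lemma vop_psum_eq:
  assumes "k > 0"
  shows "vop_psum k = fls_const (psum k) + scalz (adams_qt k \<mu>) * fls_X_inv ^ k"
proof (rule fls_eqI)
  fix n
  have dvd: "int k dvd n \<and> n div int k = j \<longleftrightarrow> n = int k * j" for j
    using assms by auto
  have "fls_nth (vop_psum k) n
      = (if int k dvd n \<and> n div int k = 0 then psum k
         else if int k dvd n \<and> n div int k = - 1 then mconst (adams_qt k \<mu>) else 0)"
    using assms fls_X_inv_power_nth[of 1 "n div int k", where 'a = "qt mfps"]
    by (auto simp: vop_psum_def fls_nth_adamsz adams_mconst)
  also have "\<dots> = fls_nth (fls_const (psum k) + scalz (adams_qt k \<mu>) * fls_X_inv ^ k) n"
    unfolding dvd using assms fls_X_inv_power_nth[of k n, where 'a = "qt mfps"] by auto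
  finally show "fls_nth (vop_psum k) n
      = fls_nth (fls_const (psum k) + scalz (adams_qt k \<mu>) * fls_X_inv ^ k) n" .
qed

lemma vop_eq: "vop \<mu> H a F = fls_nth (sym_eval scalz vop_psum F * fps_to_fls H) a"
  by (simp add: vop_def plethz_def sym_eval_def vop_psum_def[abs_def])

lemma vop_add:
  assumes "F \<in> range psum_eval" "G \<in> range psum_eval"
  shows "vop \<mu> H a (F + G) = vop \<mu> H a F + vop \<mu> H a G"
  by (simp add: vop_eq sym_eval_add[OF scalar_hom_scalz] assms distrib_right)

lemma vop_const_mult:
  assumes "F \<in> range psum_eval"
  shows "vop \<mu> H a (mconst x * F) = mconst x * vop \<mu> H a F"
  by (simp add: vop_eq sym_eval_const_mult[OF scalar_hom_scalz] assms mult.assoc)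

lemma vop_1: "vop \<mu> H a 1 = fls_nth (fps_to_fls H) a"
  by (simp add: vop_eq sym_eval_1[OF scalar_hom_scalz])

text \<open>Here p_k[X + \<mu>/z] is p_k plus p_k[\<mu>] z^(-k), and the factor z^(-k) moves the
  extracted coefficient from a to a + k.\<close>

lemma vop_psum_mult:
  assumes "k > 0" "F \<in> range psum_eval"
  shows "vop \<mu> H a (psum k * F)
    = psum k * vop \<mu> H a F + mconst (adams_qt k \<mu>) * vop \<mu> H (a + int k) F"
proof -
  let ?V = "sym_eval scalz vop_psum F * fps_to_fls H"
  have "sym_eval scalz vop_psum (psum k * F) * fps_to_fls H
      = fls_const (psum k) * ?V + scalz (adams_qt k \<mu>) * (fls_X_inv ^ k * ?V)"
    unfolding sym_eval_psum_mult[OF scalar_hom_scalz assms] vop_psum_eq[OF assms(1)]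
    by (simp add: algebra_simps)
  moreover have "fls_nth (fls_X_inv ^ k * ?V) a = fls_nth ?V (a + int k)"
    by (simp add: fls_X_inv_power_times_conv_shift)
  ultimately show ?thesis by (simp add: vop_eq)
qed

lemma vop_in_range:
  assumes "F \<in> range psum_eval" "\<And>n. fps_nth H n \<in> range psum_eval"
  shows "vop \<mu> H a F \<in> range psum_eval"
  using assms(1)
proof (induction F arbitrary: a rule: psum_eval_range_induct)
  case (const x)
  have "vop \<mu> H a 1 \<in> range psum_eval"
    using assms(2) range_psum_eval_const[of 0] by (simp add: vop_1)
  then show ?case
    using range_psum_eval_const_mult vop_const_mult[of 1 a x] range_psum_eval_const[of 1] by simp
next
  case (add F G)
  then show ?case by (simp only: vop_add range_psum_eval_add)
next
  case (psum k F)
  then show ?case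
    by (simp only: vop_psum_mult range_psum_eval_add range_psum_eval_psum_mult
        range_psum_eval_const_mult)
qed

text \<open>This is the addition formula $\Omega[we(X + \mu/z)] = \Omega[weX]\,\Omega[we\mu/z]$.\<close>

lemma vop_hseq:
  assumes K: "hseq (\<lambda>k. mconst (e k) * psum k) K"
    and g: "hseq (\<lambda>k. e k * adams_qt k \<mu>) g"
  shows "vop \<mu> H a (fls_nth (fps_to_fls K) n) = (\<Sum>j=0..n. fls_nth (fps_to_fls K) (n - j) *
    mconst (fls_nth (fps_to_fls g) j) * fls_nth (fps_to_fls H) (a + j))"
proof (cases "n \<ge> 0")
  case False
  then show ?thesis by (simp add: vop_eq sym_eval_0[OF scalar_hom_scalz])
next
  case True
  \<comment> \<open>The power series variable is w, over Laurent series in z; \<open>?g\<close> is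
    Omega[we\<mu>] with w replaced by w/z.\<close>
  let ?z = "fls_X_inv :: qt mfps fls"
  let ?K = "Abs_fps (\<lambda>n. fls_const (fps_nth K n))"
    and ?g = "Abs_fps (\<lambda>n. ?z ^ n * fps_nth (Abs_fps (\<lambda>n. scalz (fps_nth g n))) n)"
  have "hseq (\<lambda>k. fls_const (mconst (e k) * psum k)) ?K"
    by (rule hseq_map[OF _ _ _ _ K]) (simp_all add: fls_plus_const fls_const_mult_const)
  moreover have "hseq (\<lambda>k. ?z ^ k * scalz (e k * adams_qt k \<mu>)) ?g"
    by (rule hseq_scale, rule hseq_map[OF _ _ _ _ g])
      (simp_all add: mconst_add mconst_mult fls_plus_const fls_const_mult_const)
  ultimately have "hseq (\<lambda>k. fls_const (mconst (e k) * psum k)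
      + ?z ^ k * scalz (e k * adams_qt k \<mu>)) (?K * ?g)"
    by (rule hseq_mult)
  then have "hseq (\<lambda>k. scalz (e k) * vop_psum k) (?K * ?g)"
    by (rule hseq_cong)
      (simp add: vop_psum_eq algebra_simps mconst_mult flip: fls_const_mult_const)
  with hseq_sym_eval[OF scalar_hom_scalz K, of vop_psum]
  have eq: "Abs_fps (\<lambda>n. sym_eval scalz vop_psum (fps_nth K n)) = ?K * ?g"
    by (intro hseq_unique[OF mfps_fls_torsion_free])
  obtain N where N: "n = int N" using True by (metis nonneg_int_cases)
  have "sym_eval scalz vop_psum (fps_nth K N) = fps_nth (?K * ?g) N"
    using arg_cong[OF eq, of "\<lambda>f. fps_nth f N"] by simp
  also have "\<dots> = (\<Sum>j=0..N. fls_const (fps_nth K (N - j)) * (?z ^ j * scalz (fps_nth g j)))"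
    unfolding mult.commute[of ?K] fps_mult_nth by (simp add: mult.commute)
  finally have "vop \<mu> H a (fps_nth K N) = fls_nth (\<Sum>j=0..N. fls_const (fps_nth K (N - j))
      * (?z ^ j * scalz (fps_nth g j)) * fps_to_fls H) a"
    by (simp add: vop_eq sum_distrib_right)
  also have "\<dots> = (\<Sum>j=0..N. fps_nth K (N - j) * mconst (fps_nth g j)
      * fls_nth (fps_to_fls H) (a + int j))"
    unfolding fls_nth_sum
  proof (rule sum.cong)
    fix j
    have "fls_const (fps_nth K (N - j)) * (?z ^ j * scalz (fps_nth g j)) * fps_to_fls H
        = fls_const (fps_nth K (N - j)) * (scalz (fps_nth g j) * (?z ^ j * fps_to_fls H))"
      by (simp only: mult_ac)
    then show "fls_nth (fls_const (fps_nth K (N - j)) * (?z ^ j * scalz (fps_nth g j)) * fps_to_fls H) a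
        = fps_nth K (N - j) * mconst (fps_nth g j) * fls_nth (fps_to_fls H) (a + int j)"
      by (simp add: fls_X_inv_power_times_conv_shift mult.assoc)
  qed simp
  also have "\<dots> = (\<Sum>j=0..n. fls_nth (fps_to_fls K) (n - j) *
    mconst (fls_nth (fps_to_fls g) j) * fls_nth (fps_to_fls H) (a + j))"
    by (rule sum.reindex_bij_witness[where i = nat and j = int]) (auto simp: N nat_diff_distrib')
  finally show ?thesis by (simp add: N)
qed

end


section \<open>The commutator\<close>

lemma qt_nonzero: "q_var \<noteq> 0" "t_var \<noteq> 0" "q_var * t_var \<noteq> 1" "M_qt \<noteq> 0"
proof -
  show "q_var \<noteq> 0" "t_var \<noteq> 0" "q_var * t_var \<noteq> 1"
    by (simp_all add: q_var_def t_var_def Zero_fract_def One_fract_def eq_fract one_pCons)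
  have "t_var \<noteq> 1" "q_var \<noteq> 1"
    by (simp_all add: q_var_def t_var_def One_fract_def eq_fract one_pCons)
  then show "M_qt \<noteq> 0" by (simp add: M_qt_def)
qed

lemma adams_qt_M:
  assumes "k > 0"
  shows "adams_qt k M_qt = (1 - t_var ^ k) * (1 - q_var ^ k)"
    and "adams_qt k M_tilde = (1 - (1 / t_var) ^ k) * (1 - (1 / q_var) ^ k)"
  using assms by (simp_all add: M_qt_def M_tilde_def adams_qt_mult adams_qt_diff adams_qt_1
      adams_qt_divide adams_qt_q_var adams_qt_t_var power_one_over)

lemma adams_qt_M_eq:
  assumes "k > 0"
  shows "adams_qt k M_qt = (q_var * t_var) ^ k * adams_qt k M_tilde"
  unfolding adams_qt_M[OF assms] using qt_nonzero
  by (simp add: field_simps power_mult_distrib)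

abbreviation H_plus :: "qt mfps fps" where "H_plus \<equiv> omega_fps X_alph"
abbreviation H_minus :: "qt mfps fps" where "H_minus \<equiv> omega_fps (- X_alph)"

lemma hseq_H_plus: "hseq (\<lambda>k. mconst 1 * psum k) H_plus"
  using hseq_omega_fps[of X_alph] by simp

lemma hseq_H_minus: "hseq (\<lambda>k. mconst (- 1) * psum k) H_minus"
  by (rule hseq_cong[OF hseq_omega_fps]) (simp add: adams_uminus mconst_minus)

text \<open>Connects the exponential with the combinatorial definition of h_n.\<close>

lemma H_plus_eq: "H_plus = Abs_fps h_sym"
  by (rule hseq_unique[OF mfps_torsion_free hseq_omega_fps hseq_h_sym])

lemma D_op_in_range: "F \<in> range psum_eval \<Longrightarrow> D_op a F \<in> range psum_eval"
  unfolding D_op_eq by (auto intro: vop_in_range hseq_in_range[OF hseq_H_minus])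

lemma D_star_in_range: "F \<in> range psum_eval \<Longrightarrow> D_star a F \<in> range psum_eval"
  unfolding D_star_eq by (auto intro: vop_in_range hseq_in_range[OF hseq_H_plus])

section \<open>Multiplication by power sums inside the commutator\<close>

definition comm :: "int \<Rightarrow> int \<Rightarrow> qt mfps \<Rightarrow> qt mfps"
  where "comm a b F = D_op a (D_star b F) - D_star b (D_op a F)"

context
  fixes F :: "qt mfps"
  assumes F: "F \<in> range psum_eval"
begin

lemma D_op_add: "G \<in> range psum_eval \<Longrightarrow> D_op a (F + G) = D_op a F + D_op a G"
  unfolding D_op_eq by (rule vop_add[OF F])

lemma D_star_add: "G \<in> range psum_eval \<Longrightarrow> D_star a (F + G) = D_star a F + D_star a G"
  unfolding D_star_eq by (rule vop_add[OF F])

lemma D_op_const_mult: "D_op a (mconst x * F) = mconst x * D_op a F"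
  unfolding D_op_eq by (rule vop_const_mult[OF F])

lemma D_star_const_mult: "D_star a (mconst x * F) = mconst x * D_star a F"
  unfolding D_star_eq by (rule vop_const_mult[OF F])

lemma D_op_psum_mult:
  "k > 0 \<Longrightarrow> D_op a (psum k * F) = psum k * D_op a F + mconst (adams_qt k M_qt) * D_op (a + int k) F"
  unfolding D_op_eq by (rule vop_psum_mult[OF _ F])

lemma D_star_psum_mult:
  "k > 0 \<Longrightarrow> D_star b (psum k * F)
    = psum k * D_star b F - mconst (adams_qt k M_tilde) * D_star (b + int k) F"
  unfolding D_star_eq by (simp add: vop_psum_mult[OF _ F] adams_qt_uminus mconst_minus)

end

lemma comm_add:
  assumes "F \<in> range psum_eval" "G \<in> range psum_eval"
  shows "comm a b (F + G) = comm a b F + comm a b G"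
  using assms by (simp add: comm_def D_op_add D_star_add D_op_in_range D_star_in_range)

lemma comm_const_mult:
  assumes "F \<in> range psum_eval"
  shows "comm a b (mconst x * F) = mconst x * comm a b F"
  using assms by (simp add: comm_def D_op_const_mult D_star_const_mult D_op_in_range
      D_star_in_range right_diff_distrib)

text \<open>p_k shifts either the index of \<open>D_op\<close> or that of \<open>D_star\<close>,
  never both, since the scalar produced by a shift passes through the other operator. Each shifted
  product occurs in both orders, so the terms regroup into commutators.\<close>

lemma comm_psum_mult:
  assumes k: "k > 0" and F: "F \<in> range psum_eval"
  shows "comm a b (psum k * F) = psum k * comm a b F
    + mconst (adams_qt k M_qt) * comm (a + int k) b F
    - mconst (adams_qt k M_tilde) * comm a (b + int k) F"
proof -
  let ?m = "mconst (adams_qt k M_qt)" and ?n = "mconst (adams_qt k M_tilde)"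
  note range = D_op_in_range[OF F] D_star_in_range[OF F]
  note closed = range_psum_eval_psum_mult[OF k] range_psum_eval_const_mult
  have "D_op a (D_star b (psum k * F))
      = D_op a (psum k * D_star b F + mconst (- adams_qt k M_tilde) * D_star (b + int k) F)"
    by (simp add: D_star_psum_mult[OF F k] mconst_minus)
  also have "\<dots> = psum k * D_op a (D_star b F) + ?m * D_op (a + int k) (D_star b F)
      + mconst (- adams_qt k M_tilde) * D_op a (D_star (b + int k) F)"
    by (simp only: D_op_add D_op_const_mult D_op_psum_mult k closed range)
  finally have 1: "D_op a (D_star b (psum k * F)) = psum k * D_op a (D_star b F)
      + ?m * D_op (a + int k) (D_star b F) - ?n * D_op a (D_star (b + int k) F)"
    by (simp add: mconst_minus)
  have "D_star b (D_op a (psum k * F)) = D_star b (psum k * D_op a F + ?m * D_op (a + int k) F)"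
    by (simp add: D_op_psum_mult[OF F k])
  also have "\<dots> = psum k * D_star b (D_op a F) - ?n * D_star (b + int k) (D_op a F)
      + ?m * D_star b (D_op (a + int k) F)"
    by (simp only: D_star_add D_star_const_mult D_star_psum_mult k closed range)
  finally show ?thesis unfolding comm_def 1 by (simp add: algebra_simps)
qed

section \<open>The scalar series Omega[uM] and Omega[uM~]\<close>

definition M_series :: "qt fps"
  where "M_series = Abs_fps (\<lambda>n. if n = 0 then 1
    else M_qt / (q_var * t_var - 1) * ((q_var * t_var) ^ n - 1))"

definition M_tilde_series :: "qt fps"
  where "M_tilde_series = Abs_fps (\<lambda>n. if n = 0 then 1
    else - (M_qt / (q_var * t_var - 1) * (1 / (q_var * t_var) ^ n - 1)))"

lemma hseq_M_series: "hseq (\<lambda>k. 1 * adams_qt k M_qt) M_series"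
proof -
  have "hseq (\<lambda>k. (1 - t_var ^ k) * (1 - q_var ^ k)) M_series"
    using hseq_rational[of t_var q_var] qt_nonzero(3)
    unfolding M_series_def M_qt_def mult.commute[of q_var t_var] by blast
  then show ?thesis by (rule hseq_cong) (simp add: adams_qt_M)
qed

text \<open>One sign comes from applying \<open>D_star\<close> to h_a[-X], the other from the shift
  X - M~/z; together they leave Omega[uM~].\<close>

lemma hseq_M_tilde_series: "hseq (\<lambda>k. - 1 * adams_qt k (- M_tilde)) M_tilde_series"
proof -
  have eq: "(1 - 1 / t_var) * (1 - 1 / q_var) / (1 / t_var * (1 / q_var) - 1)
      * ((1 / t_var * (1 / q_var)) ^ n - 1)
      = - (M_qt / (q_var * t_var - 1) * (1 / (q_var * t_var) ^ n - 1))" for n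
  proof -
    \<comment> \<open>Inverting q and t fixes M/(qt-1) up to sign, which is the sign in
      \<open>M_tilde_series\<close>.\<close>
    have "(1 - 1 / t_var) * (1 - 1 / q_var) / (1 / t_var * (1 / q_var) - 1)
        = - (M_qt / (q_var * t_var - 1))"
      using qt_nonzero by (simp add: M_qt_def divide_simps) (simp add: algebra_simps)
    then show ?thesis by (simp add: power_one_over mult.commute power_mult_distrib)
  qed
  have "1 / t_var * (1 / q_var) \<noteq> 1"
    using qt_nonzero by (simp add: field_simps)
  from hseq_rational[OF this]
  have "hseq (\<lambda>k. (1 - (1 / t_var) ^ k) * (1 - (1 / q_var) ^ k)) M_tilde_series"
    unfolding eq by (simp only: M_tilde_series_def)
  then show ?thesis by (rule hseq_cong) (simp add: adams_qt_M adams_qt_uminus)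
qed

text \<open>
  Both series expand the same rational function, at \<open>0\<close> and at \<open>\<infinity>\<close>, so their difference is a
  combination of two formal delta functions.
\<close>

lemma M_series_diff:
  "fls_nth (fps_to_fls M_series) n - fls_nth (fps_to_fls M_tilde_series) (- n)
    = M_qt / (q_var * t_var - 1) * ((q_var * t_var) powi n - 1)"
proof -
  consider "n = 0" | "n > 0" | "n < 0" by linarith
  then show ?thesis
    by cases (simp_all add: M_series_def M_tilde_series_def power_int_def field_simps)
qed

text \<open>Omega[zX(1/(qt) - 1)], written as Omega[-zX] Omega[zX/(qt)].\<close>

definition H_diff :: "qt mfps fps"
  where "H_diff = H_minus * Abs_fps (\<lambda>n. mconst (1 / (q_var * t_var)) ^ n * fps_nth H_plus n)"

lemma mconst_power: "mconst (x ^ n) = (mconst x ^ n :: 'a :: comm_ring_1 mfps)"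
  by (induction n) (simp_all add: mconst_mult)

lemma pleth_h_sym: "pleth (h_sym n) (X_alph * mconst (1 / (q_var * t_var) - 1)) = fps_nth H_diff n"
proof -
  let ?c = "1 / (q_var * t_var)" and ?E = "X_alph * mconst (1 / (q_var * t_var) - 1)"
  have E: "adams k ?E = mconst (- 1) * psum k + mconst ?c ^ k * (mconst 1 * psum k)" if "k > 0" for k
  proof -
    have "adams_qt k (?c - 1) = ?c ^ k - 1"
      using that by (simp add: adams_qt_diff adams_qt_divide adams_qt_mult adams_qt_1
          adams_qt_q_var adams_qt_t_var power_one_over power_mult_distrib)
    then have "adams k ?E = mconst (?c ^ k - 1) * psum k"
      using adams_mconst_mult[OF that, of "?c - 1" X_alph] by (simp only: mult.commute[of X_alph])
    then show ?thesis
      by (simp add: mconst_diff mconst_minus mconst_power left_diff_distrib)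
  qed
  have "hseq (\<lambda>k. mconst (- 1) * psum k + mconst ?c ^ k * (mconst 1 * psum k)) H_diff"
    unfolding H_diff_def by (intro hseq_mult hseq_H_minus hseq_scale hseq_H_plus)
  then have "hseq (\<lambda>k. adams k ?E) H_diff"
    by (rule hseq_cong) (simp only: E)
  moreover have "hseq (\<lambda>k. adams k ?E)
      (Abs_fps (\<lambda>n. sym_eval mconst (\<lambda>k. adams k ?E) (fps_nth H_plus n)))"
    using hseq_sym_eval[OF scalar_hom_mconst hseq_H_plus, of "\<lambda>k. adams k ?E"] by simp
  ultimately have "Abs_fps (\<lambda>n. sym_eval mconst (\<lambda>k. adams k ?E) (fps_nth H_plus n)) = H_diff"
    by (intro hseq_unique[OF mfps_torsion_free])
  from arg_cong[OF this, of "\<lambda>f. fps_nth f n"] show ?thesis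
    by (simp add: pleth_def sym_eval_def H_plus_eq)
qed

section \<open>The commutator on constants and the final induction\<close>

lemma comm_1:
  assumes "a + b > 0"
  shows "comm a b 1 = mconst (M_qt / (q_var * t_var - 1) * (q_var * t_var) powi b)
    * fps_nth H_diff (nat (a + b))"
proof -
  let ?p = "fls_nth (fps_to_fls H_plus)" and ?m = "fls_nth (fps_to_fls H_minus)"
    and ?g = "fls_nth (fps_to_fls M_series)" and ?g' = "fls_nth (fps_to_fls M_tilde_series)"
    and ?Q = "q_var * t_var" and ?N = "a + b"
  let ?f = "M_qt / (?Q - 1)"
  have "D_op a (D_star b 1) = (\<Sum>j=0..b. ?p (b - j) * mconst (?g j) * ?m (a + j))"
    unfolding D_op_eq D_star_eq vop_1 by (rule vop_hseq[OF hseq_H_plus hseq_M_series])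
  also have "\<dots> = (\<Sum>i=a..?N. ?p (?N - i) * mconst (?g (i - a)) * ?m i)"
    by (rule sum.reindex_bij_witness[where i = "\<lambda>i. i - a" and j = "\<lambda>j. a + j"])
      (auto simp: algebra_simps)
  \<comment> \<open>Coefficients at negative indices are 0: for a < 0 the dropped terms have h_i[-X]
    = 0, and for a > 0 the added ones have a vanishing coefficient of
    \<open>M_series\<close>.\<close>
  also have "\<dots> = (\<Sum>i=0..?N. ?p (?N - i) * mconst (?g (i - a)) * ?m i)"
    by (rule sum.mono_neutral_cong) auto
  finally have 1: "D_op a (D_star b 1) = (\<Sum>i=0..?N. ?p (?N - i) * mconst (?g (i - a)) * ?m i)" .
  have "D_star b (D_op a 1) = (\<Sum>j=0..a. ?m (a - j) * mconst (?g' j) * ?p (b + j))"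
    unfolding D_op_eq D_star_eq vop_1 by (rule vop_hseq[OF hseq_H_minus hseq_M_tilde_series])
  also have "\<dots> = (\<Sum>i=0..a. ?p (?N - i) * mconst (?g' (- (i - a))) * ?m i)"
    by (rule sum.reindex_bij_witness[where i = "\<lambda>i. a - i" and j = "\<lambda>j. a - j"])
      (auto simp: algebra_simps)
  \<comment> \<open>Likewise, terms beyond a have a vanishing coefficient of
    \<open>M_tilde_series\<close>, and terms beyond a+b have h_{a+b-i}[X] = 0. Both products are now
    indexed by the degree i of h_i[-X].\<close>
  also have "\<dots> = (\<Sum>i=0..?N. ?p (?N - i) * mconst (?g' (- (i - a))) * ?m i)"
    by (rule sum.mono_neutral_cong) auto
  finally have 2: "D_star b (D_op a 1)
      = (\<Sum>i=0..?N. ?p (?N - i) * mconst (?g' (- (i - a))) * ?m i)" .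
  have "comm a b 1 = (\<Sum>i=0..?N. ?p (?N - i) * mconst (?g (i - a) - ?g' (- (i - a))) * ?m i)"
    unfolding comm_def 1 2 by (simp add: mconst_diff algebra_simps sum_subtractf)
  also have "\<dots> = (\<Sum>i=0..?N. mconst (?f * ?Q powi b) * (?m i * (mconst ((1 / ?Q) ^ nat (?N - i)) * ?p (?N - i)))
      - mconst ?f * (?m i * ?p (?N - i)))"
  proof (rule sum.cong)
    \<comment> \<open>As i - a = b - (a+b-i), the geometric part separates into (qt)^b and the
      weight (qt)^(-(a+b-i)) that rescales the alphabet of h_{a+b-i}.\<close>
    fix i assume i: "i \<in> {0..?N}"
    have "(1 / ?Q) ^ nat (?N - i) = 1 / ?Q powi (?N - i)"
      using i by (simp add: power_int_def power_one_over)
    then have "?Q powi b * (1 / ?Q) ^ nat (?N - i) = ?Q powi (b - (?N - i))"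
      using power_int_diff[of ?Q b "?N - i"] qt_nonzero by simp
    then have "?f * (?Q powi (i - a) - 1) = ?f * ?Q powi b * (1 / ?Q) ^ nat (?N - i) - ?f"
      by (simp add: algebra_simps)
    then have *: "mconst (?g (i - a) - ?g' (- (i - a)))
        = mconst (?f * ?Q powi b) * mconst ((1 / ?Q) ^ nat (?N - i)) - mconst ?f"
      unfolding M_series_diff by (simp only: mconst_mult mconst_diff)
    show "?p (?N - i) * mconst (?g (i - a) - ?g' (- (i - a))) * ?m i
        = mconst (?f * ?Q powi b) * (?m i * (mconst ((1 / ?Q) ^ nat (?N - i)) * ?p (?N - i)))
          - mconst ?f * (?m i * ?p (?N - i))"
      unfolding * by (simp only: left_diff_distrib right_diff_distrib mult_ac)
  qed simp
  also have "\<dots> = mconst (?f * ?Q powi b) * (\<Sum>i=0..?N. ?m i * (mconst ((1 / ?Q) ^ nat (?N - i)) * ?p (?N - i)))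
      - mconst ?f * (\<Sum>i=0..?N. ?m i * ?p (?N - i))"
    by (simp only: sum_subtractf sum_distrib_left)
  also have "(\<Sum>i=0..?N. ?m i * (mconst ((1 / ?Q) ^ nat (?N - i)) * ?p (?N - i))) = fps_nth H_diff (nat ?N)"
    unfolding H_diff_def fps_mult_nth
    by (rule sum.reindex_bij_witness[where i = int and j = nat])
      (use assms in \<open>auto simp: nat_diff_distrib' mconst_power\<close>)
  also have "(\<Sum>i=0..?N. ?m i * ?p (?N - i)) = fps_nth (H_minus * H_plus) (nat ?N)"
    unfolding fps_mult_nth
    by (rule sum.reindex_bij_witness[where i = int and j = nat])
      (use assms in \<open>auto simp: nat_diff_distrib'\<close>)
  \<comment> \<open>The constant part is a coefficient of Omega[z(X-X)] = 1, which vanishes in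
    positive degree a+b.\<close>
  also have "H_minus * H_plus = 1"
  proof (rule hseq_unique[OF mfps_torsion_free _ hseq_1])
    show "hseq (\<lambda>_. 0) (H_minus * H_plus)"
      by (rule hseq_cong[OF hseq_mult[OF hseq_H_minus hseq_H_plus]]) (simp add: mconst_minus)
  qed
  finally show ?thesis using assms by simp
qed

text \<open>The induction keeps a and b arbitrary because p_k raises one of them by k; the sum then
  only increases, so positivity persists.\<close>

lemma comm_eq:
  assumes "F \<in> range psum_eval" "a + b > 0"
  shows "comm a b F = mconst (M_qt / (q_var * t_var - 1) * (q_var * t_var) powi b)
    * fps_nth H_diff (nat (a + b)) * F"
  using assms
proof (induction F arbitrary: a b rule: psum_eval_range_induct)
  case (const x)
  have "1 \<in> range psum_eval" using range_psum_eval_const[of 1] by simp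
  from comm_const_mult[OF this, of a b x] show ?case
    using comm_1[OF const] by (simp add: mult_ac)
next
  case (add F G)
  then show ?case by (simp add: comm_add distrib_left)
next
  case (psum k F)
  let ?f = "M_qt / (q_var * t_var - 1)" and ?Q = "q_var * t_var" and ?H = "fps_nth H_diff (nat (a + b + int k))"
  have "?Q powi (b + int k) = ?Q powi b * ?Q ^ k"
    using qt_nonzero by (simp add: power_int_add)
  then have "adams_qt k M_qt * (?f * ?Q powi b) = adams_qt k M_tilde * (?f * ?Q powi (b + int k))"
    using adams_qt_M_eq[OF psum.hyps(1)] by (simp add: mult_ac)
  \<comment> \<open>The two shifted commutators enter with opposite signs and equal weights, leaving
    only multiplication by p_k.\<close>
  then have cancel: "mconst (adams_qt k M_qt) * mconst (?f * ?Q powi b)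
      = (mconst (adams_qt k M_tilde) * mconst (?f * ?Q powi (b + int k)) :: qt mfps)"
    by (simp only: flip: mconst_mult)
  have "a + int k + b = a + b + int k" "a + (b + int k) = a + b + int k" by simp_all
  moreover have "a + b + int k > 0" using psum.prems by simp
  ultimately have
    "comm (a + int k) b F = mconst (?f * ?Q powi b) * ?H * F"
    "comm a (b + int k) F = mconst (?f * ?Q powi (b + int k)) * ?H * F"
    using psum.IH[of "a + int k" b] psum.IH[of a "b + int k"] by (simp_all only:)
  then have "mconst (adams_qt k M_qt) * comm (a + int k) b F
      = mconst (adams_qt k M_tilde) * comm a (b + int k) F"
    using cancel by (simp only: flip: mult.assoc)
  then show ?case
    using comm_psum_mult[OF psum.hyps] psum.IH[OF psum.prems] by (simp add: mult_ac)
qed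

theorem theorem1p2:
  fixes a b :: int and F :: "qt mfps"
  assumes "a + b > 0" and "F \<in> symfun"
  shows "mconst (1 / M_qt) * (D_op a (D_star b F) - D_star b (D_op a F)) =
    mconst ((q_var * t_var) powi b / (q_var * t_var - 1)) *
      pleth (h_sym (nat (a + b))) (X_alph * mconst (1 / (q_var * t_var) - 1)) * F"
proof -
  have "mconst (1 / M_qt) * mconst (M_qt / (q_var * t_var - 1) * (q_var * t_var) powi b)
      = (mconst ((q_var * t_var) powi b / (q_var * t_var - 1)) :: qt mfps)"
    using qt_nonzero(4) by (simp flip: mconst_mult)
  then show ?thesis
    using comm_eq[OF symfun_in_range[OF assms(2)] assms(1)]
    unfolding comm_def pleth_h_sym by (simp flip: mult.assoc)
qed

end
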